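(* Let $T_1$ be a tree of order $n_1$ having $r_1$ non-pendent vertices, and let $T_2$ be a tree of diameter at most $3$ and order $n_2$, with $n_1\ge n_2\ge 6$. Let $\sigma_1$ be the number of Laplacian eigenvalues of $T_1$ (with multiplicity) greater than or equal to the average degree $\overline{d}(T_1)=2-\frac{2}{n_1}$. Let $T$ be the tree of order $n=n_1+n_2$ obtained from $T_1\cup T_2$ by adding an edge $uv$ with $u\in V(T_1)$, $v\in V(T_2)$. If $\sigma_1=r_1$ and $LE(T_1)\ge 2+\frac{4n_1}{\pi}$, then $LE(T)\ge 2+\frac{4n}{\pi}$, and consequently $LE(T)\ge LE(P_n)$, where $P_n$ is the path on $n$ vertices.
   Context: For a graph $G$ with $n$ vertices and $m$ edges, let $\mu_1\ge\dots\ge\mu_n$ be the Laplacian eigenvalues (eigenvalues of $D(G)-A(G)$) and $\overline{d}=2m/n$; the Laplacian energy is $LE(G)=\sum_{i=1}^n|\mu_i-\overline{d}|$. Non-pendent vertices are vertices of degree greater than $1$. *)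

theory Defs
  imports
    Complex_Main
    "Graph_Theory.Graph_Theory"
    "Jordan_Normal_Form.Char_Poly"
begin

text \<open>
  A finite simple graph is a \<^locale>\<open>pair_graph\<close>: a finite, loop-free digraph without
  parallel arcs whose arc relation is symmetric. Each undirected edge is thus the pair of
  arcs (u,v), (v,u), and the degree of a vertex is its \<^const>\<open>out_degree\<close>.
\<close>

definition graph_order :: "'a pair_pre_digraph \<Rightarrow> nat" where
  "graph_order G = card (pverts G)"

definition graph_size :: "'a pair_pre_digraph \<Rightarrow> nat" where
  "graph_size G = card {{u, v} |u v. (u, v) \<in> parcs G}"

definition avg_degree :: "'a pair_pre_digraph \<Rightarrow> real" where
  "avg_degree G = 2 * real (graph_size G) / real (graph_order G)"

definition non_pendent :: "'a pair_pre_digraph \<Rightarrow> 'a set" where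
  "non_pendent G = {v \<in> pverts G. out_degree (with_proj G) v > 1}"

text \<open>
  The constant \<^const>\<open>Digraph_Component.tree\<close> forbids all directed cycles, hence also
  the closed walk along (u,v), (v,u); for symmetric digraphs only cycles of length at least 3
  are cycles of the undirected graph. Connectedness includes having at least one vertex.
\<close>

definition undirected_tree :: "'a pair_pre_digraph \<Rightarrow> bool" where
  "undirected_tree G \<longleftrightarrow>
     pair_graph G \<and> Digraph_Component.connected (with_proj G) \<and>
     \<not> (\<exists>p. pre_digraph.cycle (with_proj G) p \<and> length p \<ge> 3)"

definition graph_distance :: "'a pair_pre_digraph \<Rightarrow> 'a \<Rightarrow> 'a \<Rightarrow> ereal" where
  "graph_distance G = wf_digraph.\<mu> (with_proj G) (\<lambda>_. 1)"

definition graph_diameter :: "'a pair_pre_digraph \<Rightarrow> ereal" where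
  "graph_diameter G = (SUP u\<in>pverts G. SUP v\<in>pverts G. graph_distance G u v)"

definition join_by_edge ::
  "'a pair_pre_digraph \<Rightarrow> 'a \<Rightarrow> 'a \<Rightarrow> 'a pair_pre_digraph \<Rightarrow> 'a pair_pre_digraph" where
  "join_by_edge G u v H =
     \<lparr> pverts = pverts G \<union> pverts H, parcs = parcs G \<union> parcs H \<union> {(u, v), (v, u)} \<rparr>"

definition path_graph :: "nat \<Rightarrow> nat pair_pre_digraph" where
  "path_graph n =
     \<lparr> pverts = {..<n}, parcs = {(i, j). i < n \<and> j < n \<and> (j = Suc i \<or> i = Suc j)} \<rparr>"


text \<open>Matrices are taken with respect to a list \<open>xs\<close> enumerating the vertices.\<close>

definition degree_matrix :: "'a pair_pre_digraph \<Rightarrow> 'a list \<Rightarrow> real mat" where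
  "degree_matrix G xs = mat (length xs) (length xs)
     (\<lambda>(i, j). if i = j then real (out_degree (with_proj G) (xs ! i)) else 0)"

definition adjacency_matrix :: "'a pair_pre_digraph \<Rightarrow> 'a list \<Rightarrow> real mat" where
  "adjacency_matrix G xs = mat (length xs) (length xs)
     (\<lambda>(i, j). if (xs ! i, xs ! j) \<in> parcs G then 1 else 0)"

definition laplacian_matrix :: "'a pair_pre_digraph \<Rightarrow> 'a list \<Rightarrow> real mat" where
  "laplacian_matrix G xs = degree_matrix G xs - adjacency_matrix G xs"

definition vertex_list :: "'a pair_pre_digraph \<Rightarrow> 'a list" where
  "vertex_list G = (SOME xs. distinct xs \<and> set xs = pverts G)"

text \<open>
  The Laplacian eigenvalues as a multiset: the roots of the characteristic polynomial with
  multiplicity. By \<open>laplacian_spectrum_eq\<close> below the choice of \<^const>\<open>vertex_list\<close>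
  does not matter.
\<close>

definition laplacian_spectrum :: "'a pair_pre_digraph \<Rightarrow> real multiset" where
  "laplacian_spectrum G = proots (char_poly (laplacian_matrix G (vertex_list G)))"

definition laplacian_energy :: "'a pair_pre_digraph \<Rightarrow> real" where
  "laplacian_energy G = (\<Sum>\<mu>\<in>#laplacian_spectrum G. \<bar>\<mu> - avg_degree G\<bar>)"

lemma similar_mat_reindex:
  fixes f :: "nat \<Rightarrow> nat \<Rightarrow> real"
  assumes s: "bij_betw s {..<n} {..<n}"
  shows "similar_mat (mat n n (\<lambda>(i, j). f (s i) (s j))) (mat n n (\<lambda>(i, j). f i j))"
proof -
  define P where "P = mat n n (\<lambda>(i, j). if j = s i then 1 else (0::real))"
  define Q where "Q = mat n n (\<lambda>(i, j). if i = s j then 1 else (0::real))"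
  let ?B = "mat n n (\<lambda>(i, j). f i j)" and ?A = "mat n n (\<lambda>(i, j). f (s i) (s j))"
  have s_lt: "s i < n" if "i < n" for i using s that by (auto simp: bij_betw_def)
  have s_eq: "s i = s j \<longleftrightarrow> i = j" if "i < n" "j < n" for i j
    using s that by (auto simp: bij_betw_def inj_on_def)
  have C: "P \<in> carrier_mat n n" "Q \<in> carrier_mat n n" "?A \<in> carrier_mat n n" "?B \<in> carrier_mat n n"
    by (auto simp: P_def Q_def)
  have PQ: "P * Q = 1\<^sub>m n"
    by (rule eq_matI)
      (auto simp: P_def Q_def scalar_prod_def s_eq s_lt if_distrib[where f="\<lambda>x. x * _"]
        if_distrib[where f="\<lambda>x. _ * x"] sum.delta cong: if_cong)
  have QP: "Q * P = 1\<^sub>m n" by (rule mat_mult_left_right_inverse[OF C(1,2) PQ])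
  have PB: "P * ?B = mat n n (\<lambda>(i, j). f (s i) j)"
    by (rule eq_matI)
      (auto simp: P_def scalar_prod_def s_lt if_distrib[where f="\<lambda>x. x * _"] sum.delta
        cong: if_cong)
  have "?A = P * ?B * Q"
    unfolding PB
    by (rule eq_matI)
      (auto simp: Q_def scalar_prod_def s_lt if_distrib[where f="\<lambda>x. _ * x"] sum.delta
        cong: if_cong)
  then have "similar_mat_wit ?A ?B P Q"
    unfolding similar_mat_wit_def Let_def using C PQ QP by (metis carrier_matD(1) insert_subset empty_subsetI)
  then show ?thesis unfolding similar_mat_def by blast
qed

lemma char_poly_laplacian_matrix_cong:
  assumes "distinct xs" "distinct ys" "set xs = set ys"
  shows "char_poly (laplacian_matrix G xs) = char_poly (laplacian_matrix G ys)"
proof -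
  define n where "n = length xs"
  have n: "length ys = n" using assms by (metis distinct_card n_def)
  define f where "f = (\<lambda>i j. (if i = j then real (out_degree (with_proj G) (ys ! i)) else 0)
    - (if (ys ! i, ys ! j) \<in> parcs G then 1 else 0))"
  define s where "s = (\<lambda>i. inv_into {..<n} ((!) ys) (xs ! i))"
  have bys: "bij_betw ((!) ys) {..<n} (set ys)" using assms n bij_betw_nth[of ys] by blast
  have bx: "bij_betw ((!) xs) {..<n} (set ys)" using assms n_def bij_betw_nth[of xs] by metis
  have bs: "bij_betw s {..<n} {..<n}"
    using bij_betw_trans[OF bx bij_betw_inv_into[OF bys]] by (simp add: s_def comp_def)
  have ys: "ys ! s i = xs ! i" if "i < n" for i
    unfolding s_def using bys bx that by (intro f_inv_into_f) (auto simp: bij_betw_def)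
  have s_eq: "s i = s j \<longleftrightarrow> i = j" if "i < n" "j < n" for i j
    using bs that by (auto simp: bij_betw_def inj_on_def)
  have "laplacian_matrix G xs = mat n n (\<lambda>(i, j). f (s i) (s j))"
    by (rule eq_matI)
      (auto simp: laplacian_matrix_def degree_matrix_def adjacency_matrix_def f_def ys s_eq
        n_def[symmetric])
  moreover have "laplacian_matrix G ys = mat n n (\<lambda>(i, j). f i j)"
    by (rule eq_matI)
      (auto simp: laplacian_matrix_def degree_matrix_def adjacency_matrix_def f_def n)
  ultimately show ?thesis
    using char_poly_similar[OF similar_mat_reindex[OF bs, of f]] by simp
qed

lemma laplacian_spectrum_eq:
  assumes "distinct xs" "set xs = pverts G"
  shows "laplacian_spectrum G = proots (char_poly (laplacian_matrix G xs))"
proof -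
  have "distinct (vertex_list G) \<and> set (vertex_list G) = pverts G"
    unfolding vertex_list_def by (rule someI[of _ xs]) (use assms in simp)
  then show ?thesis
    unfolding laplacian_spectrum_def
    using char_poly_laplacian_matrix_cong[of "vertex_list G" xs G] assms by simp
qed

end

theory Submission
  imports Defs "Jordan_Normal_Form.Schur_Decomposition" "HOL-Analysis.L2_Norm"
begin

text \<open>
  If \<open>f\<^sub>1, \<dots>, f\<^sub>k\<close> are orthonormal, then \<open>LE(T)\<close> is at least twice the sum of the
  \<open>f\<^sub>i\<^sup>T L(T) f\<^sub>i - d\<close>, where \<open>d\<close> is the average degree of \<open>T\<close>. Take for the \<open>f\<^sub>i\<close> the eigenvectors of \<open>T\<^sub>1\<close>
  with eigenvalue at least its average degree, which recover \<open>LE(T\<^sub>1)\<close>, and the eigenvectors of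
  \<open>T\<^sub>2\<close> with eigenvalue at least \<open>d\<close>. As \<open>T\<^sub>2\<close> is a star or a double star, test vectors bound the
  contribution of the latter. For small \<open>n\<^sub>2\<close> this is not quite enough, and the new edge must be used:
  with \<open>z = e\<^sub>u - e\<^sub>v\<close> and \<open>p\<close> the squared norm of the projection of \<open>z\<close> to the span of the
  family, the edge adds \<open>p\<close> to the sum; if \<open>p\<close> is small, then enlarging the family by the
  normalized residual of \<open>z\<close> adds \<open>2 - d + (D - q) / (2 - p)\<close>, where \<open>D\<close> is the sum of the degrees of
  \<open>u\<close> and \<open>v\<close> and \<open>q\<close> is the part of it carried by the family, at most \<open>\<surd>p D\<close>. The number of selected
  eigenvectors of \<open>T\<^sub>1\<close> is controlled by the hypothesis on \<open>LE(T\<^sub>1)\<close>, because the Laplacian is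
  positive semidefinite.
\<close>

section \<open>Diagonalization of real symmetric matrices\<close>

text \<open>The obstacle is a tight budget, counted in half energies. Passing from T1 to T raises
  the target by \<open>2 * n2 / pi\<close>, about 0.637 \<open>n2\<close>. The threshold rises too,
  from \<open>2 - 2 / n1\<close> to \<open>2 - 2 / n\<close>, so every selected eigenvector of T1
  loses \<open>2 / n1 - 2 / n\<close>; the energy hypothesis forces fewer than
  \<open>43/63 * n1\<close> of them, and with \<open>n2 \<le> n1\<close> the total loss stays below
  43/63. Up to terms of order 1/n, a star T2 is shown to contribute \<open>n2 - 2\<close> and a
  double star on at least seven vertices \<open>n2 - 258/100\<close>, which is too little when
  \<open>n2\<close> is small. The edge therefore has to supply a fixed amount: 1/2 if p > 1/2, and
  at least 39/100 + 2/n if p is at most 1/2. For a double star on six vertices even this is so tight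
  that the integrality of the number of selected eigenvectors is used. The comparison with the path
  holds because its explicit spectrum and a Dirichlet kernel estimate give LE(P_n) at most 2 +
  4n/pi.\<close>

lemma symmetric_real_mat_eigenvalue:
  fixes A :: "real mat"
  assumes A: "A \<in> carrier_mat n n" and n: "n > 0"
    and sym: "\<And>i j. i < n \<Longrightarrow> j < n \<Longrightarrow> A $$ (i, j) = A $$ (j, i)"
  shows "\<exists>e. eigenvalue A e"
proof -
  define B where "B = map_mat complex_of_real A"
  have B: "B \<in> carrier_mat n n" using A by (simp add: B_def)
  obtain zs where zs: "char_poly B = (\<Prod>a\<leftarrow>zs. [:- a, 1:])" "length zs = n"
    using char_poly_factorized[OF B] by blast
  then obtain z where z: "z \<in> set zs" using n by (cases zs) auto
  have root: "poly (char_poly B) z = 0"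
    unfolding zs(1) poly_prod_list by (subst prod_list_zero_iff) (use z in auto)
  then obtain v where v: "eigenvector B v z"
    using eigenvalue_root_char_poly[OF B] unfolding eigenvalue_def by blast
  have vc: "v \<in> carrier_vec n" and v0: "v \<noteq> 0\<^sub>v n" and ev: "B *\<^sub>v v = z \<cdot>\<^sub>v v"
    using v B by (auto simp: eigenvector_def)
  have ev': "(\<Sum>j<n. A $$ (i, j) * v $ j) = z * v $ i" if "i < n" for i
  proof -
    have "(B *\<^sub>v v) $ i = (z \<cdot>\<^sub>v v) $ i" by (simp add: ev)
    then show ?thesis using that A vc B
      by (simp add: scalar_prod_def B_def lessThan_atLeast0)
  qed
  define N where "N = (\<Sum>i<n. (cmod (v $ i))\<^sup>2)"
  have N: "N \<noteq> 0"
  proof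
    assume "N = 0"
    then have "v $ i = 0" if "i < n" for i
      using that by (auto simp: N_def sum_nonneg_eq_0_iff)
    then have "v = 0\<^sub>v n" using vc by (intro eq_vecI) auto
    then show False using v0 by simp
  qed
  \<comment> \<open>The Hermitian form of \<open>v\<close> is evaluated in two ways. As the matrix
    is real and symmetric, the second gives \<open>cnj z * N\<close>, so the complex root
    \<open>z\<close> is real.\<close>
  have "z * N = (\<Sum>i<n. cnj (v $ i) * (z * v $ i))"
    unfolding N_def of_real_sum sum_distrib_left
    by (rule sum.cong[OF refl]) (simp only: complex_norm_square mult_ac)
  also have "\<dots> = (\<Sum>i<n. \<Sum>j<n. A $$ (i, j) * (cnj (v $ i) * v $ j))"
    by (rule sum.cong) (simp_all add: ev'[symmetric] sum_distrib_left mult_ac)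
  also have "\<dots> = (\<Sum>j<n. \<Sum>i<n. A $$ (j, i) * (cnj (v $ i) * v $ j))"
    by (subst sum.swap) (intro sum.cong refl, simp add: sym)
  also have "\<dots> = (\<Sum>j<n. v $ j * cnj (z * v $ j))"
    by (rule sum.cong) (simp_all add: ev'[symmetric] sum_distrib_left mult_ac)
  also have "\<dots> = cnj z * N"
    unfolding N_def of_real_sum sum_distrib_left
    by (rule sum.cong[OF refl]) (simp only: complex_norm_square complex_cnj_mult mult_ac)
  finally have "z = cnj z" using N by simp
  then have "z = of_real (Re z)" by (simp add: complex_eq_iff)
  then have "poly (map_poly of_real (char_poly A)) (complex_of_real (Re z)) = 0"
    using root of_real_hom.char_poly_hom[OF A, where 'a=complex] by (simp add: B_def)
  then have "poly (char_poly A) (Re z) = 0" by (simp add: of_real_hom.poly_map_poly)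
  then show ?thesis using eigenvalue_root_char_poly[OF A] by blast
qed

text \<open>Gram-Schmidt applied to a basis that begins with \<open>v\<close> leaves its head
  unchanged, and normalizing only rescales it. Over the reals conjugation is trivial, so
  \<open>corthogonal\<close> is ordinary orthogonality.\<close>

lemma orthonormal_mat_with_first_col:
  fixes v :: "real vec"
  assumes v: "v \<in> carrier_vec n" and v0: "v \<noteq> 0\<^sub>v n" 
  shows "\<exists>W \<in> carrier_mat n n. W\<^sup>T * W = 1\<^sub>m n \<and> (\<exists>c. col W 0 = c \<cdot>\<^sub>v v)"
proof -
  interpret cof_vec_space n "TYPE(real)" .
  have n: "n > 0" using v v0 by (cases n) auto
  define b where "b = basis_completion v"
  from basis_completion[OF v v0, folded b_def]
  have dist_b: "distinct b" and indep: "\<not> lin_dep (set b)" and b: "set b \<subseteq> carrier_vec n"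
    and hdb: "hd b = v" and len_b: "length b = n" by auto
  define ws where "ws = gram_schmidt n b"
  obtain vs where bv: "b = v # vs" using hdb len_b n by (cases b) auto
  from gram_schmidt_result[OF b dist_b indep ws_def]
  have ws: "set ws \<subseteq> carrier_vec n" "corthogonal ws" "length ws = n" by (auto simp: len_b)
  have hdws: "hd ws = v" using gram_schmidt_hd[OF v, of vs, folded bv] unfolding ws_def .
  have conj: "conjugate w = w" if "w \<in> carrier_vec n" for w :: "real vec"
    using that by (intro eq_vecI) auto
  have wsc: "ws ! i \<in> carrier_vec n" if "i < n" for i using ws that by (metis nth_mem subsetD)
  have orth: "ws ! i \<bullet> ws ! j = 0 \<longleftrightarrow> i \<noteq> j" if "i < n" "j < n" for i j
    using corthogonalD[OF ws(2)] that ws(3) conj[OF wsc[OF that(2)]] by simp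
  have pos: "ws ! i \<bullet> ws ! i > 0" if "i < n" for i
  proof -
    have "ws ! i \<bullet> ws ! i \<ge> 0" by (auto simp: scalar_prod_def intro!: sum_nonneg)
    then show ?thesis using orth[OF that that] by simp
  qed
  define us where "us = map (\<lambda>w. (1 / sqrt (w \<bullet> w)) \<cdot>\<^sub>v w) ws"
  define W where "W = mat_of_cols n us"
  have us: "us ! i = (1 / sqrt (ws ! i \<bullet> ws ! i)) \<cdot>\<^sub>v (ws ! i)" if "i < n" for i
    using that ws(3) by (simp add: us_def)
  have len: "length us = n" using ws(3) by (simp add: us_def)
  have W: "W \<in> carrier_mat n n" using mat_of_cols_carrier(1)[of n us] by (simp add: W_def len)
  have colW: "col W i = us ! i" if "i < n" for i
    unfolding W_def using that wsc[OF that] len by (intro col_mat_of_cols) (auto simp: us)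
  have "W\<^sup>T * W = 1\<^sub>m n"
  proof (rule eq_matI)
    fix i j assume "i < dim_row (1\<^sub>m n :: real mat)" "j < dim_col (1\<^sub>m n :: real mat)"
    then have ij: "i < n" "j < n" by auto
    have "(W\<^sup>T * W) $$ (i, j) = us ! i \<bullet> us ! j" using W ij by (simp add: colW)
    also have "\<dots> = (1 / sqrt (ws ! i \<bullet> ws ! i)) * ((1 / sqrt (ws ! j \<bullet> ws ! j)) * (ws ! i \<bullet> ws ! j))"
      using wsc ij by (simp add: us smult_scalar_prod_distrib[of _ n] scalar_prod_smult_distrib[of _ n])
    also have "\<dots> = (if i = j then 1 else 0)"
      using orth[OF ij] pos[OF ij(1)] by (auto simp: field_simps)
    finally show "(W\<^sup>T * W) $$ (i, j) = 1\<^sub>m n $$ (i, j)" using ij by simp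
  qed (use W in auto)
  moreover have "col W 0 = (1 / sqrt (v \<bullet> v)) \<cdot>\<^sub>v v"
    using colW[OF n] us[OF n] hdws ws(3) n by (cases ws) auto
  ultimately show ?thesis using W by blast
qed

text \<open>Deflation: in an orthonormal basis that begins with an eigenvector the first column of
  the matrix is cleared below the diagonal, symmetry clears the first row, and the induction
  hypothesis applies to the remaining block.\<close>

lemma real_symmetric_diagonalization:
  fixes A :: "real mat"
  assumes "A \<in> carrier_mat n n"
    and "\<And>i j. i < n \<Longrightarrow> j < n \<Longrightarrow> A $$ (i, j) = A $$ (j, i)"
  shows "\<exists>Q D. Q \<in> carrier_mat n n \<and> D \<in> carrier_mat n n \<and> diagonal_mat D \<and>
    Q\<^sup>T * Q = 1\<^sub>m n \<and> A * Q = Q * D"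
  using assms
proof (induction n arbitrary: A)
  case 0
  then show ?case
    by (intro exI[of _ "1\<^sub>m 0"] exI[of _ "1\<^sub>m 0"]) (auto simp: diagonal_mat_def)
next
  case (Suc m)
  let ?n = "Suc m"
  note A = Suc.prems(1) and sym = Suc.prems(2)
  obtain e v where ev: "eigenvector A v e"
    using symmetric_real_mat_eigenvalue[OF A _ sym] unfolding eigenvalue_def by auto
  have v: "v \<in> carrier_vec ?n" "v \<noteq> 0\<^sub>v ?n" "A *\<^sub>v v = e \<cdot>\<^sub>v v"
    using ev A by (auto simp: eigenvector_def)
  obtain W c where W: "W \<in> carrier_mat ?n ?n" and WtW: "W\<^sup>T * W = 1\<^sub>m ?n" and c: "col W 0 = c \<cdot>\<^sub>v v"
    using orthonormal_mat_with_first_col[OF v(1,2)] by blast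
  have Wt: "W\<^sup>T \<in> carrier_mat ?n ?n" using W by simp
  have WWt: "W * W\<^sup>T = 1\<^sub>m ?n" by (rule mat_mult_left_right_inverse[OF Wt W WtW])
  define A' where "A' = W\<^sup>T * (A * W)"
  have AW: "A * W \<in> carrier_mat ?n ?n" using A W by simp
  have A': "A' \<in> carrier_mat ?n ?n" unfolding A'_def using Wt AW by simp
  have At: "A\<^sup>T = A" using A sym by (intro eq_matI) auto
  have A't: "A'\<^sup>T = A'"
  proof -
    have "A'\<^sup>T = (W\<^sup>T * A) * W"
      unfolding A'_def using A W Wt AW
      by (simp add: transpose_mult[of _ ?n ?n _ ?n] At)
    also have "\<dots> = A'" unfolding A'_def by (rule assoc_mult_mat[OF Wt A W])
    finally show ?thesis .
  qed
  have A'sym: "A' $$ (i, j) = A' $$ (j, i)" if "i < ?n" "j < ?n" for i j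
    using A't A' that by (metis carrier_matD index_transpose_mat(1))
  have col0: "A' $$ (i, 0) = (if i = 0 then e else 0)" if i: "i < ?n" for i
  proof -
    have "col (A * W) 0 = A *\<^sub>v col W 0" using A W by (intro col_mult2) auto
    also have "\<dots> = e \<cdot>\<^sub>v col W 0" unfolding c using A v
      by (simp add: mult_mat_vec smult_smult_assoc mult.commute)
    finally have cl: "col (A * W) 0 = e \<cdot>\<^sub>v col W 0" .
    have "A' $$ (i, 0) = col W i \<bullet> col (A * W) 0" unfolding A'_def using W A i by simp
    also have "\<dots> = e * (col W i \<bullet> col W 0)" unfolding cl using W i by simp
    also have "col W i \<bullet> col W 0 = (W\<^sup>T * W) $$ (i, 0)" using W i by simp
    also have "\<dots> = (if i = 0 then 1 else 0)" unfolding WtW using i by simp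
    finally show ?thesis by simp
  qed
  define A3 where "A3 = mat m m (\<lambda>(i, j). A' $$ (Suc i, Suc j))"
  have A3: "A3 \<in> carrier_mat m m" by (simp add: A3_def)
  obtain Q3 D3 where Q3: "Q3 \<in> carrier_mat m m" and D3: "D3 \<in> carrier_mat m m" "diagonal_mat D3"
    and orth3: "Q3\<^sup>T * Q3 = 1\<^sub>m m" and AQ3: "A3 * Q3 = Q3 * D3"
    using Suc.IH[OF A3] A'sym by (auto simp: A3_def)
  let ?E = "mat 1 1 (\<lambda>_. e)"
  define F where "F = four_block_mat (1\<^sub>m 1) (0\<^sub>m 1 m) (0\<^sub>m m 1) Q3"
  define D where "D = four_block_mat ?E (0\<^sub>m 1 m) (0\<^sub>m m 1) D3"
  have A'_block: "A' = four_block_mat ?E (0\<^sub>m 1 m) (0\<^sub>m m 1) A3"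
  proof (rule eq_matI, goal_cases)
    case (1 i j)
    then have ij: "i < ?n" "j < ?n" using A3 by auto
    then show ?case using col0[of i] col0[of j] A'sym[of 0 j] by (auto simp: A3_def)
  qed (use A' A3 in auto)
  have F: "F \<in> carrier_mat ?n ?n" and D: "D \<in> carrier_mat ?n ?n"
    using Q3 D3 by (auto simp: F_def D_def)
  have FtF: "F\<^sup>T * F = 1\<^sub>m ?n"
  proof -
    have "F\<^sup>T = four_block_mat (1\<^sub>m 1) (0\<^sub>m 1 m) (0\<^sub>m m 1) Q3\<^sup>T"
      unfolding F_def using Q3 by (subst transpose_four_block_mat[of _ 1 1 _ m _ m]) auto
    also have "\<dots> * F = 1\<^sub>m ?n"
      unfolding F_def using Q3 orth3
      by (subst mult_four_block_mat[of _ 1 1 _ m _ m _ _ 1 _ m]) (auto intro!: eq_matI)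
    finally show ?thesis .
  qed
  have A'F: "A' * F = F * D"
    unfolding A'_block F_def D_def using Q3 A3 D3 AQ3
    by (simp add: mult_four_block_mat[of _ 1 1 _ m _ m _ _ 1 _ m])
  have Q: "W * F \<in> carrier_mat ?n ?n" using W F by simp
  have "(W * F)\<^sup>T * (W * F) = F\<^sup>T * (W\<^sup>T * W * F)"
    using W F Wt by (simp add: transpose_mult[of _ ?n ?n _ ?n] assoc_mult_mat[of _ ?n ?n _ ?n _ ?n])
  also have "\<dots> = 1\<^sub>m ?n" using F FtF WtW by simp
  finally have orth: "(W * F)\<^sup>T * (W * F) = 1\<^sub>m ?n" .
  have "W * A' = W * W\<^sup>T * (A * W)" unfolding A'_def by (rule assoc_mult_mat[symmetric, OF W Wt AW])
  then have WA': "W * A' = A * W" using left_mult_one_mat[OF AW] WWt by simp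
  have "A * (W * F) = W * A' * F" unfolding WA' by (rule assoc_mult_mat[symmetric, OF A W F])
  also have "\<dots> = W * (F * D)" unfolding A'F[symmetric] by (rule assoc_mult_mat[OF W A' F])
  also have "\<dots> = W * F * D" by (rule assoc_mult_mat[symmetric, OF W F D])
  finally have AQ: "A * (W * F) = W * F * D" .
  have "diagonal_mat D" unfolding diagonal_mat_def D_def using D3
    by (auto simp: diagonal_mat_def)
  then show ?case using Q D orth AQ by blast
qed


text \<open>The columns of the orthogonal matrix as plain functions. The second family of equations
  is completeness, from which Parseval and the trace formula follow; the factorization ties
  \<open>ev\<close> to the spectrum with multiplicity.\<close>

lemma symmetric_mat_orthonormal_eigenbasis:
  fixes A :: "real mat"
  assumes A: "A \<in> carrier_mat n n"
    and sym: "\<And>i j. i < n \<Longrightarrow> j < n \<Longrightarrow> A $$ (i, j) = A $$ (j, i)"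
  shows "\<exists>(g :: nat \<Rightarrow> nat \<Rightarrow> real) ev.
    (\<forall>i<n. \<forall>j<n. (\<Sum>k<n. g i k * g j k) = (if i = j then 1 else 0)) \<and>
    (\<forall>i<n. \<forall>j<n. (\<Sum>k<n. g k i * g k j) = (if i = j then 1 else 0)) \<and>
    (\<forall>i<n. \<forall>k<n. (\<Sum>l<n. A $$ (k, l) * g i l) = ev i * g i k) \<and>
    char_poly A = (\<Prod>i\<leftarrow>[0..<n]. [:- ev i, 1:])"
proof -
  obtain Q D where Q: "Q \<in> carrier_mat n n" and D: "D \<in> carrier_mat n n" "diagonal_mat D"
    and QtQ: "Q\<^sup>T * Q = 1\<^sub>m n" and AQ: "A * Q = Q * D"
    using real_symmetric_diagonalization[OF A sym] by blast
  have Qt: "Q\<^sup>T \<in> carrier_mat n n" using Q by simp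
  have QQt: "Q * Q\<^sup>T = 1\<^sub>m n" by (rule mat_mult_left_right_inverse[OF Qt Q QtQ])
  have D0: "D $$ (i, j) = 0" if "i < n" "j < n" "i \<noteq> j" for i j
    using D that by (auto simp: diagonal_mat_def)
  have "similar_mat_wit A D Q Q\<^sup>T"
  proof (rule similar_mat_witI[OF QQt QtQ _ A D(1) Q Qt])
    have "A = A * (Q * Q\<^sup>T)" using A QQt by simp
    also have "\<dots> = A * Q * Q\<^sup>T" by (rule assoc_mult_mat[symmetric, OF A Q Qt])
    finally show "A = Q * D * Q\<^sup>T" using AQ by simp
  qed
  then have "char_poly A = char_poly D" by (intro char_poly_similar) (auto simp: similar_mat_def)
  also have "\<dots> = (\<Prod>a\<leftarrow>diag_mat D. [:- a, 1:])"
    using D by (intro char_poly_upper_triangular[of _ n]) (auto simp: diagonal_mat_def)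
  also have "diag_mat D = map (\<lambda>i. D $$ (i, i)) [0..<n]" using D by (simp add: diag_mat_def)
  finally have cp: "char_poly A = (\<Prod>i\<leftarrow>[0..<n]. [:- (D $$ (i, i)), 1:])" by (simp add: o_def)
  have "(\<Sum>k<n. Q $$ (k, i) * Q $$ (k, j)) = (if i = j then 1 else 0)" if "i < n" "j < n" for i j
  proof -
    have "(Q\<^sup>T * Q) $$ (i, j) = 1\<^sub>m n $$ (i, j)" by (simp add: QtQ)
    then show ?thesis using Q that by (simp add: scalar_prod_def lessThan_atLeast0)
  qed
  moreover have "(\<Sum>k<n. Q $$ (i, k) * Q $$ (j, k)) = (if i = j then 1 else 0)" if "i < n" "j < n" for i j
  proof -
    have "(Q * Q\<^sup>T) $$ (i, j) = 1\<^sub>m n $$ (i, j)" by (simp add: QQt)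
    then show ?thesis using Q that by (simp add: scalar_prod_def lessThan_atLeast0)
  qed
  moreover have "(\<Sum>l<n. A $$ (k, l) * Q $$ (l, i)) = D $$ (i, i) * Q $$ (k, i)" if "i < n" "k < n" for i k
  proof -
    have "(A * Q) $$ (k, i) = (Q * D) $$ (k, i)" by (simp add: AQ)
    then have "(\<Sum>l<n. A $$ (k, l) * Q $$ (l, i)) = (\<Sum>l<n. Q $$ (k, l) * D $$ (l, i))"
      using A Q D that by (simp add: scalar_prod_def lessThan_atLeast0)
    also have "\<dots> = (\<Sum>l<n. if l = i then Q $$ (k, i) * D $$ (i, i) else 0)"
      using that by (intro sum.cong) (auto simp: D0)
    finally show ?thesis using that by simp
  qed
  ultimately show ?thesis using cp
    by (intro exI[of _ "\<lambda>i k. Q $$ (k, i)"] exI[of _ "\<lambda>i. D $$ (i, i)"]) simp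
qed

section \<open>The Laplacian as a quadratic form\<close>

definition inner_on :: "'a set \<Rightarrow> ('a \<Rightarrow> real) \<Rightarrow> ('a \<Rightarrow> real) \<Rightarrow> real" where
  "inner_on V f g = (\<Sum>x\<in>V. f x * g x)"

definition orthonormal_on :: "'a set \<Rightarrow> 'i set \<Rightarrow> ('i \<Rightarrow> 'a \<Rightarrow> real) \<Rightarrow> bool" where
  "orthonormal_on V I f \<longleftrightarrow> (\<forall>i\<in>I. \<forall>j\<in>I. inner_on V (f i) (f j) = (if i = j then 1 else 0))"

text \<open>Each edge is counted by both of its arcs, hence the division by 2.\<close>

definition dirichlet :: "('a \<times> 'a) set \<Rightarrow> ('a \<Rightarrow> real) \<Rightarrow> ('a \<Rightarrow> real) \<Rightarrow> real" where
  "dirichlet E f g = (\<Sum>(x, y)\<in>E. (f x - f y) * (g x - g y)) / 2"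

definition laplacian :: "('a \<times> 'a) set \<Rightarrow> ('a \<Rightarrow> real) \<Rightarrow> 'a \<Rightarrow> real" where
  "laplacian E f x = (\<Sum>y | (x, y) \<in> E. f x - f y)"

lemma inner_on_commute: "inner_on V f g = inner_on V g f"
  by (simp add: inner_on_def mult.commute)

lemma inner_on_self_nonneg: "inner_on V f f \<ge> 0"
  by (simp add: inner_on_def sum_nonneg)

lemma inner_on_sum_left: "inner_on V (\<lambda>x. \<Sum>i\<in>I. c i * f i x) h = (\<Sum>i\<in>I. c i * inner_on V (f i) h)"
  unfolding inner_on_def sum_distrib_left sum_distrib_right
  by (subst sum.swap) (simp add: mult.assoc)

lemma inner_on_diff_left: "inner_on V (\<lambda>x. f x - g x) h = inner_on V f h - inner_on V g h"
  by (simp add: inner_on_def left_diff_distrib sum_subtractf)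

lemma inner_on_diff_right: "inner_on V h (\<lambda>x. f x - g x) = inner_on V h f - inner_on V h g"
  by (simp add: inner_on_def right_diff_distrib sum_subtractf)

lemma inner_on_cong: "(\<And>x. x \<in> V \<Longrightarrow> f x = f' x) \<Longrightarrow> (\<And>x. x \<in> V \<Longrightarrow> g x = g' x) \<Longrightarrow>
  inner_on V f g = inner_on V f' g'"
  by (simp add: inner_on_def)

lemma inner_on_scale_right: "inner_on V h (\<lambda>x. c * f x) = c * inner_on V h f"
  by (simp add: inner_on_def sum_distrib_left mult_ac)

lemma orthonormal_onD:
  "orthonormal_on V I f \<Longrightarrow> i \<in> I \<Longrightarrow> j \<in> I \<Longrightarrow> inner_on V (f i) (f j) = (if i = j then 1 else 0)"
  by (simp add: orthonormal_on_def)

lemma orthonormal_projection: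
  fixes h :: "'a \<Rightarrow> real"
  assumes "orthonormal_on V I f" "finite I"
  defines "w \<equiv> \<lambda>x. h x - (\<Sum>i\<in>I. inner_on V (f i) h * f i x)"
  shows "\<And>i. i \<in> I \<Longrightarrow> inner_on V (f i) w = 0"
    and "inner_on V w w = inner_on V h h - (\<Sum>i\<in>I. (inner_on V (f i) h)\<^sup>2)"
proof -
  have *: "inner_on V (f j) (\<lambda>x. \<Sum>i\<in>I. inner_on V (f i) h * f i x) = inner_on V (f j) h" if "j \<in> I" for j
  proof -
    have "inner_on V (f j) (\<lambda>x. \<Sum>i\<in>I. inner_on V (f i) h * f i x)
        = (\<Sum>i\<in>I. inner_on V (f i) h * inner_on V (f i) (f j))"
      by (subst inner_on_commute, subst inner_on_sum_left) simp
    also have "\<dots> = (\<Sum>i\<in>I. if i = j then inner_on V (f j) h else 0)"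
      by (rule sum.cong) (use orthonormal_onD[OF assms(1)] that in auto)
    finally show ?thesis using that assms(2) by simp
  qed
  show **: "inner_on V (f i) w = 0" if "i \<in> I" for i
    using *[OF that] by (simp add: w_def inner_on_diff_right)
  have "inner_on V w w = inner_on V h w - (\<Sum>i\<in>I. inner_on V (f i) h * inner_on V (f i) w)"
    by (subst w_def, subst inner_on_diff_left, subst inner_on_sum_left) simp
  also have "\<dots> = inner_on V h w" using ** by simp
  also have "\<dots> = inner_on V h h - inner_on V h (\<lambda>x. \<Sum>i\<in>I. inner_on V (f i) h * f i x)"
    by (simp add: w_def inner_on_diff_right)
  also have "inner_on V h (\<lambda>x. \<Sum>i\<in>I. inner_on V (f i) h * f i x) = (\<Sum>i\<in>I. (inner_on V (f i) h)\<^sup>2)"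
    by (subst inner_on_commute, subst inner_on_sum_left) (simp add: power2_eq_square)
  finally show "inner_on V w w = inner_on V h h - (\<Sum>i\<in>I. (inner_on V (f i) h)\<^sup>2)" .
qed

lemma bessel_inequality:
  assumes "orthonormal_on V I f" "finite I"
  shows "(\<Sum>i\<in>I. (inner_on V (f i) h)\<^sup>2) \<le> inner_on V h h"
  using orthonormal_projection(2)[OF assms, of h]
    inner_on_self_nonneg[of V "\<lambda>x. h x - (\<Sum>i\<in>I. inner_on V (f i) h * f i x)"] by linarith

text \<open>Summation by parts: exchanging the two arcs of each edge turns
  \<open>f x * (g x - g y)\<close> into \<open>f y * (g y - g x)\<close>, and the average of the two
  sums is the symmetric form.\<close>

lemma inner_on_laplacian:
  assumes V: "finite V" and E: "E \<subseteq> V \<times> V" "sym E"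
  shows "inner_on V f (laplacian E g) = dirichlet E f g"
proof -
  have fE: "finite E" using V E finite_subset by blast
  have sw: "(\<Sum>(x, y)\<in>E. F x y) = (\<Sum>(x, y)\<in>E. F y x)" for F :: "'a \<Rightarrow> 'a \<Rightarrow> real"
    by (rule sum.reindex_bij_witness[of _ prod.swap prod.swap]) (use E in \<open>auto dest: symD\<close>)
  have "inner_on V f (laplacian E g) = (\<Sum>x\<in>V. \<Sum>y | (x, y) \<in> E. f x * (g x - g y))"
    by (simp add: inner_on_def laplacian_def sum_distrib_left)
  also have "\<dots> = (\<Sum>(x, y)\<in>(SIGMA x:V. {y. (x, y) \<in> E}). f x * (g x - g y))"
    by (rule sum.Sigma) (use V E in \<open>auto intro: finite_subset[OF _ V]\<close>)
  also have "(SIGMA x:V. {y. (x, y) \<in> E}) = E" using E by auto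
  finally have *: "inner_on V f (laplacian E g) = (\<Sum>(x, y)\<in>E. f x * (g x - g y))" .
  then have "2 * inner_on V f (laplacian E g)
      = (\<Sum>(x, y)\<in>E. f x * (g x - g y)) + (\<Sum>(x, y)\<in>E. f y * (g y - g x))"
    using sw[of "\<lambda>x y. f x * (g x - g y)"] by simp
  also have "\<dots> = (\<Sum>(x, y)\<in>E. (f x - f y) * (g x - g y))"
    unfolding sum.distrib[symmetric] by (rule sum.cong) (auto simp: algebra_simps)
  finally show ?thesis by (simp add: dirichlet_def)
qed

lemma dirichlet_commute: "dirichlet E f g = dirichlet E g f"
  by (simp add: dirichlet_def mult.commute)

lemma dirichlet_self: "dirichlet E f f = (\<Sum>(x, y)\<in>E. (f x - f y)\<^sup>2) / 2"
  by (simp add: dirichlet_def power2_eq_square)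

lemma dirichlet_self_nonneg: "dirichlet E f f \<ge> 0"
  by (auto simp: dirichlet_self intro!: sum_nonneg)

lemma inner_on_zero: "(\<And>x. x \<in> V \<Longrightarrow> f x = 0) \<Longrightarrow> inner_on V f f' = 0"
  by (simp add: inner_on_def)

lemma dirichlet_cong:
  "(\<And>x. x \<in> V \<Longrightarrow> f x = f' x) \<Longrightarrow> E \<subseteq> V \<times> V \<Longrightarrow> dirichlet E f f = dirichlet E f' f'"
  unfolding dirichlet_self by (intro arg_cong2[where f="(/)"] sum.cong refl) auto

lemma dirichlet_zero: "(\<And>x. x \<in> V \<Longrightarrow> f x = 0) \<Longrightarrow> E \<subseteq> V \<times> V \<Longrightarrow> dirichlet E f f = 0"
  by (subst dirichlet_cong[of V f "\<lambda>_. 0"]) (auto simp: dirichlet_def)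

lemma pair_graph_simps:
  assumes "pair_graph G"
  shows "finite (pverts G)" "finite (parcs G)" "parcs G \<subseteq> pverts G \<times> pverts G" "sym (parcs G)"
    "(x, y) \<in> parcs G \<Longrightarrow> x \<noteq> y"
proof -
  interpret pair_graph G by fact
  show "finite (pverts G)" "finite (parcs G)" by (rule pair_finite_verts, rule pair_finite_arcs)
  show "parcs G \<subseteq> pverts G \<times> pverts G" using in_arcsD1 in_arcsD2 by auto
  show "sym (parcs G)" by (rule symI) (rule arcs_symmetric)
  show "(x, y) \<in> parcs G \<Longrightarrow> x \<noteq> y" by (rule no_loops')
qed

lemma card_arcs_eq:
  assumes G: "pair_graph G"
  shows "card (parcs G) = 2 * graph_size G"
proof -
  note S = pair_graph_simps[OF G]
  let ?e = "\<lambda>(u, v). {u, v}"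
  have im: "?e ` parcs G = {{u, v} |u v. (u, v) \<in> parcs G}" by auto
  have "card (parcs G) = (\<Sum>s\<in>?e ` parcs G. card {p \<in> parcs G. ?e p = s})"
    using sum.group[OF S(2), of "?e ` parcs G" ?e "\<lambda>_. 1::nat"] S(2) by simp
  also have "\<dots> = (\<Sum>s\<in>?e ` parcs G. 2)"
  proof (rule sum.cong[OF refl])
    fix s assume "s \<in> ?e ` parcs G"
    then obtain u v where uv: "s = {u, v}" "(u, v) \<in> parcs G" by auto
    then have "{p \<in> parcs G. ?e p = s} = {(u, v), (v, u)}" "u \<noteq> v"
      using S(4,5) by (auto simp: doubleton_eq_iff dest: symD)
    then show "card {p \<in> parcs G. ?e p = s} = 2" by simp
  qed
  also have "\<dots> = 2 * graph_size G" unfolding im graph_size_def by simp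
  finally show ?thesis .
qed

lemma out_degree_eq:
  "out_degree (with_proj G) x = card {y. (x, y) \<in> parcs G}"
proof -
  have "out_arcs (with_proj G) x = Pair x ` {y. (x, y) \<in> parcs G}"
    by (auto simp: out_arcs_def)
  then show ?thesis by (simp add: out_degree_def card_image inj_on_def)
qed

text \<open>The eigenbasis is carried from indices to vertices along an enumeration. Vanishing off
  the vertex set lets the eigenfunctions of both halves serve unchanged as functions on the joined
  tree.\<close>

lemma orthonormal_laplacian_eigenfunctions:
  assumes G: "pair_graph G"
  shows "\<exists>(g :: nat \<Rightarrow> 'a \<Rightarrow> real) ev.
    orthonormal_on (pverts G) {..<graph_order G} g \<and>
    (\<forall>x\<in>pverts G. \<forall>y\<in>pverts G. (\<Sum>i<graph_order G. g i x * g i y) = (if x = y then 1 else 0)) \<and>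
    (\<forall>i<graph_order G. \<forall>x\<in>pverts G. laplacian (parcs G) (g i) x = ev i * g i x) \<and>
    (\<forall>i x. x \<notin> pverts G \<longrightarrow> g i x = 0) \<and>
    laplacian_spectrum G = mset (map ev [0..<graph_order G])"
proof -
  note S = pair_graph_simps[OF G]
  let ?V = "pverts G" and ?n = "graph_order G"
  obtain xs where xs: "distinct xs" "set xs = ?V"
    using finite_distinct_list[OF S(1)] by blast
  have len: "length xs = ?n" using xs by (metis distinct_card graph_order_def)
  let ?A = "laplacian_matrix G xs"
  have A: "?A \<in> carrier_mat ?n ?n"
    unfolding laplacian_matrix_def degree_matrix_def adjacency_matrix_def len by (intro minus_carrier_mat) simp
  have A_nth: "?A $$ (i, j) = (if i = j then real (card {y. (xs ! i, y) \<in> parcs G}) else 0)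
      - (if (xs ! i, xs ! j) \<in> parcs G then 1 else 0)" if "i < ?n" "j < ?n" for i j
    using that by (simp add: laplacian_matrix_def degree_matrix_def adjacency_matrix_def len out_degree_eq)
  have sym: "?A $$ (i, j) = ?A $$ (j, i)" if "i < ?n" "j < ?n" for i j
    using that S(4) by (auto simp: A_nth dest: symD)
  obtain h ev where h: "\<And>i j. i < ?n \<Longrightarrow> j < ?n \<Longrightarrow> (\<Sum>k<?n. h i k * h j k) = (if i = j then 1 else (0::real))"
      "\<And>i j. i < ?n \<Longrightarrow> j < ?n \<Longrightarrow> (\<Sum>k<?n. h k i * h k j) = (if i = j then 1 else (0::real))"
      "\<And>i k. i < ?n \<Longrightarrow> k < ?n \<Longrightarrow> (\<Sum>l<?n. ?A $$ (k, l) * h i l) = ev i * h i k"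
    and cp: "char_poly ?A = (\<Prod>i\<leftarrow>[0..<?n]. [:- ev i, 1:])"
    using symmetric_mat_orthonormal_eigenbasis[OF A sym] by blast
  define idx where "idx = inv_into {..<?n} ((!) xs)"
  have bij: "bij_betw ((!) xs) {..<?n} ?V" by (rule bij_betw_nth[OF xs(1)]) (simp_all add: len xs(2))
  have idx: "idx (xs ! k) = k" if "k < ?n" for k
    unfolding idx_def by (rule inv_into_f_f[OF bij_betw_imp_inj_on[OF bij]]) (use that in simp)
  have xs_idx: "\<exists>k<?n. x = xs ! k" if "x \<in> ?V" for x
    using that unfolding xs(2)[symmetric] len[symmetric] in_set_conv_nth by auto
  have nth_V: "xs ! k \<in> ?V" if "k < ?n" for k
    using nth_mem[of k xs] that len xs(2) by simp
  define g where "g i x = (if x \<in> ?V then h i (idx x) else 0)" for i x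
  have gx: "g i (xs ! k) = h i k" if "k < ?n" for i k
    using that nth_V by (simp add: g_def idx)
  have sumV: "(\<Sum>x\<in>?V. F x) = (\<Sum>k<?n. F (xs ! k))" for F :: "'a \<Rightarrow> real"
    by (rule sum.reindex_bij_betw[symmetric]) (rule bij)
  have "orthonormal_on ?V {..<?n} g"
    by (simp add: orthonormal_on_def inner_on_def sumV gx h(1))
  moreover have "(\<Sum>i<?n. g i x * g i y) = (if x = y then 1 else 0)" if xy: "x \<in> ?V" "y \<in> ?V" for x y
  proof -
    obtain k l where kl: "k < ?n" "x = xs ! k" "l < ?n" "y = xs ! l"
      using xs_idx[OF xy(1)] xs_idx[OF xy(2)] by blast
    have "x = y \<longleftrightarrow> k = l" unfolding kl(2,4) using idx[OF kl(1)] idx[OF kl(3)] by metis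
    moreover have "(\<Sum>i<?n. g i x * g i y) = (if k = l then 1 else 0)"
      unfolding kl(2,4) gx[OF kl(1)] gx[OF kl(3)] by (rule h(2)[OF kl(1,3)])
    ultimately show ?thesis by simp
  qed
  moreover have "laplacian (parcs G) (g i) x = ev i * g i x" if i: "i < ?n" and x: "x \<in> ?V" for i x
  proof -
    obtain k where k: "k < ?n" "x = xs ! k" using xs_idx[OF x] by blast
    have sub: "{y. (x, y) \<in> parcs G} \<subseteq> ?V" using S(3) by auto
    have fin: "finite {y. (x, y) \<in> parcs G}" using finite_subset[OF sub S(1)] .
    have "ev i * g i x = (\<Sum>l<?n. ?A $$ (k, l) * h i l)"
      unfolding k(2) gx[OF k(1)] by (rule h(3)[OF i k(1), symmetric])
    also have "\<dots> = (\<Sum>l<?n. (if k = l then real (card {y. (x, y) \<in> parcs G}) * g i x else 0)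
        - (if (x, xs ! l) \<in> parcs G then g i (xs ! l) else 0))"
      unfolding k(2) by (rule sum.cong[OF refl]) (simp add: A_nth k(1) gx left_diff_distrib)
    also have "\<dots> = real (card {y. (x, y) \<in> parcs G}) * g i x
        - (\<Sum>y\<in>?V. if (x, y) \<in> parcs G then g i y else 0)"
      unfolding sum_subtractf sumV using k(1) by simp
    also have "(\<Sum>y\<in>?V. if (x, y) \<in> parcs G then g i y else 0) = (\<Sum>y | (x, y) \<in> parcs G. g i y)"
      unfolding sum.inter_filter[OF S(1), symmetric] by (rule sum.cong) (use sub in auto)
    finally show ?thesis using fin by (simp add: laplacian_def sum_subtractf)
  qed
  moreover have "\<forall>i x. x \<notin> ?V \<longrightarrow> g i x = 0" by (simp add: g_def)
  moreover have "laplacian_spectrum G = mset (map ev [0..<?n])"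
  proof -
    have "proots (\<Prod>i\<leftarrow>js. [:- ev i, 1:]) = mset (map ev js)" for js :: "nat list"
    proof (induction js)
      case (Cons j js)
      have "(\<Prod>i\<leftarrow>js. [:- ev i, 1:]) \<noteq> 0" by (auto simp: prod_list_zero_iff)
      then have "proots ([:- ev j, 1:] * (\<Prod>i\<leftarrow>js. [:- ev i, 1:])) = {#ev j#} + mset (map ev js)"
        using Cons by (subst proots_mult) simp_all
      then show ?case by simp
    qed simp
    then show ?thesis using laplacian_spectrum_eq[OF xs] cp by simp
  qed
  ultimately show ?thesis by blast
qed

lemma orthonormal_on_subset: "orthonormal_on V J f \<Longrightarrow> I \<subseteq> J \<Longrightarrow> orthonormal_on V I f"
  unfolding orthonormal_on_def by blast

section \<open>Spectral calculus for the Laplacian of one graph\<close>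

locale laplacian_eigenbasis =
  fixes G :: "'a pair_pre_digraph" and g :: "nat \<Rightarrow> 'a \<Rightarrow> real" and ev :: "nat \<Rightarrow> real"
  assumes graph: "pair_graph G"
    and orthonormal: "orthonormal_on (pverts G) {..<graph_order G} g"
    and complete: "\<And>x y. x \<in> pverts G \<Longrightarrow> y \<in> pverts G \<Longrightarrow>
      (\<Sum>i<graph_order G. g i x * g i y) = (if x = y then 1 else 0)"
    and eigen: "\<And>i x. i < graph_order G \<Longrightarrow> x \<in> pverts G \<Longrightarrow> laplacian (parcs G) (g i) x = ev i * g i x"
    and support: "\<And>i x. x \<notin> pverts G \<Longrightarrow> g i x = 0"
    and spectrum: "laplacian_spectrum G = mset (map ev [0..<graph_order G])"
begin

lemmas simps = pair_graph_simps[OF graph]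

lemma expansion:
  assumes "x \<in> pverts G"
  shows "f x = (\<Sum>i<graph_order G. inner_on (pverts G) (g i) f * g i x)"
proof -
  have "(\<Sum>i<graph_order G. inner_on (pverts G) (g i) f * g i x)
      = (\<Sum>y\<in>pverts G. f y * (\<Sum>i<graph_order G. g i y * g i x))"
    unfolding inner_on_def sum_distrib_left sum_distrib_right
    by (subst sum.swap) (simp add: mult_ac)
  also have "\<dots> = (\<Sum>y\<in>pverts G. if y = x then f x else 0)"
    by (rule sum.cong) (use assms complete in auto)
  also have "\<dots> = f x" using assms simps(1) by simp
  finally show ?thesis by simp
qed

lemma inner_on_expansion:
  "inner_on (pverts G) f h = (\<Sum>i<graph_order G. inner_on (pverts G) (g i) f * inner_on (pverts G) (g i) h)"
proof -
  have "inner_on (pverts G) f h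
      = inner_on (pverts G) (\<lambda>x. \<Sum>i<graph_order G. inner_on (pverts G) (g i) f * g i x) h"
    by (rule inner_on_cong) (simp_all add: expansion[symmetric])
  then show ?thesis by (simp add: inner_on_sum_left)
qed

lemma dirichlet_eigen:
  assumes "i < graph_order G"
  shows "dirichlet (parcs G) f (g i) = ev i * inner_on (pverts G) (g i) f"
proof -
  have "dirichlet (parcs G) f (g i) = inner_on (pverts G) f (\<lambda>x. ev i * g i x)"
    unfolding inner_on_laplacian[OF simps(1,3,4), symmetric]
    by (rule inner_on_cong) (use assms eigen in auto)
  then show ?thesis by (simp add: inner_on_scale_right inner_on_commute)
qed

lemma dirichlet_expansion:
  "dirichlet (parcs G) f f = (\<Sum>i<graph_order G. ev i * (inner_on (pverts G) (g i) f)\<^sup>2)"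
proof -
  have "dirichlet (parcs G) f f
      = (\<Sum>i<graph_order G. inner_on (pverts G) (g i) f * dirichlet (parcs G) (g i) f)"
    unfolding inner_on_laplacian[OF simps(1,3,4), symmetric] by (rule inner_on_expansion)
  also have "\<dots> = (\<Sum>i<graph_order G. ev i * (inner_on (pverts G) (g i) f)\<^sup>2)"
    by (rule sum.cong) (simp_all add: dirichlet_commute[of _ _ f] dirichlet_eigen power2_eq_square)
  finally show ?thesis .
qed

lemma ev_eq: 
  assumes "i < graph_order G"
  shows "ev i = dirichlet (parcs G) (g i) (g i)"
  using dirichlet_eigen[OF assms, of "g i"] orthonormal_onD[OF orthonormal, of i i] assms by simp

lemma ev_nonneg: "i < graph_order G \<Longrightarrow> ev i \<ge> 0"
  by (simp add: ev_eq dirichlet_self_nonneg)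

text \<open>The trace, edge by edge: by completeness the squared differences of all eigenfunctions
  along an arc add up to 1 + 1 - 0, as its ends are distinct.\<close>

lemma sum_ev: "(\<Sum>i<graph_order G. ev i) = 2 * real (graph_size G)"
proof -
  have "(\<Sum>i<graph_order G. ev i) = (\<Sum>i<graph_order G. (\<Sum>(x, y)\<in>parcs G. (g i x - g i y)\<^sup>2) / 2)"
    by (rule sum.cong) (simp_all add: ev_eq dirichlet_self)
  also have "\<dots> = (\<Sum>(x, y)\<in>parcs G. \<Sum>i<graph_order G. (g i x - g i y)\<^sup>2) / 2"
    unfolding sum_divide_distrib[symmetric] by (subst sum.swap) (simp add: case_prod_beta)
  also have "(\<Sum>(x, y)\<in>parcs G. \<Sum>i<graph_order G. (g i x - g i y)\<^sup>2) = (\<Sum>(x, y)\<in>parcs G. 2)"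
  proof (intro sum.cong refl, clarify)
    fix x y assume xy: "(x, y) \<in> parcs G"
    have "(\<Sum>i<graph_order G. (g i x - g i y)\<^sup>2) = (\<Sum>i<graph_order G. g i x * g i x)
        + (\<Sum>i<graph_order G. g i y * g i y) - 2 * (\<Sum>i<graph_order G. g i x * g i y)"
      unfolding sum_distrib_left sum_subtractf[symmetric] sum.distrib[symmetric]
      by (rule sum.cong) (auto simp: power2_eq_square algebra_simps)
    also have "\<dots> = 2" using complete[of x x] complete[of y y] complete[of x y] simps(3,5) xy by auto
    finally show "(\<Sum>i<graph_order G. (g i x - g i y)\<^sup>2) = 2" .
  qed
  also have "\<dots> = 2 * real (card (parcs G))" by (simp add: case_prod_unfold)
  finally show ?thesis using card_arcs_eq[OF graph] by simp
qed

lemma sum_ev_minus_avg: "(\<Sum>i<graph_order G. ev i - avg_degree G) = 0"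
proof (cases "graph_order G = 0")
  case False
  then show ?thesis by (simp add: sum_subtractf sum_ev avg_degree_def)
qed simp

lemma laplacian_energy_sum: "laplacian_energy G = (\<Sum>i<graph_order G. \<bar>ev i - avg_degree G\<bar>)"
proof -
  have "laplacian_energy G = sum_list (map (\<lambda>i. \<bar>ev i - avg_degree G\<bar>) [0..<graph_order G])"
    unfolding laplacian_energy_def spectrum
    by (simp only: mset_map[symmetric] sum_mset_sum_list map_map o_def)
  then show ?thesis by (simp add: interv_sum_list_conv_sum_set_nat lessThan_atLeast0)
qed

text \<open>The deviations from the average degree sum to zero, so their positive parts make up half
  of the energy.\<close>

lemma laplacian_energy_max:
  "laplacian_energy G = 2 * (\<Sum>i<graph_order G. max 0 (ev i - avg_degree G))"
proof -
  have "laplacian_energy G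
      = (\<Sum>i<graph_order G. 2 * max 0 (ev i - avg_degree G) - (ev i - avg_degree G))"
    unfolding laplacian_energy_sum by (rule sum.cong) (auto simp: abs_if max_def)
  also have "\<dots> = 2 * (\<Sum>i<graph_order G. max 0 (ev i - avg_degree G))"
    unfolding sum_subtractf[of _ "\<lambda>i. ev i - avg_degree G"] sum_ev_minus_avg
    by (simp add: sum_distrib_left)
  finally show ?thesis .
qed

text \<open>
  By Bessel's inequality an orthonormal family puts total weight at most one on every
  eigenvector, so its compression cannot exceed the sum of the positive parts.
\<close>

lemma orthonormal_family_le:
  assumes f: "orthonormal_on (pverts G) I f" "finite I"
  shows "(\<Sum>i\<in>I. dirichlet (parcs G) (f i) (f i) - t) \<le> (\<Sum>j<graph_order G. max 0 (ev j - t))"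
proof -
  let ?c = "\<lambda>i j. (inner_on (pverts G) (g j) (f i))\<^sup>2"
  have "(\<Sum>i\<in>I. dirichlet (parcs G) (f i) (f i) - t) = (\<Sum>i\<in>I. \<Sum>j<graph_order G. (ev j - t) * ?c i j)"
  proof (rule sum.cong[OF refl])
    fix i assume i: "i \<in> I"
    have "t = t * inner_on (pverts G) (f i) (f i)" using orthonormal_onD[OF f(1) i i] by simp
    also have "\<dots> = (\<Sum>j<graph_order G. t * ?c i j)"
      by (subst inner_on_expansion) (simp add: power2_eq_square sum_distrib_left)
    finally show "dirichlet (parcs G) (f i) (f i) - t = (\<Sum>j<graph_order G. (ev j - t) * ?c i j)"
      by (simp add: dirichlet_expansion left_diff_distrib sum_subtractf)
  qed
  also have "\<dots> = (\<Sum>j<graph_order G. (ev j - t) * (\<Sum>i\<in>I. ?c i j))"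
    by (subst sum.swap) (simp add: sum_distrib_left)
  also have "\<dots> \<le> (\<Sum>j<graph_order G. max 0 (ev j - t))"
  proof (rule sum_mono)
    fix j assume "j \<in> {..<graph_order G}"
    then have "inner_on (pverts G) (g j) (g j) = 1" using orthonormal_onD[OF orthonormal, of j j] by simp
    moreover have "?c i j = (inner_on (pverts G) (f i) (g j))\<^sup>2" for i
      by (simp only: inner_on_commute)
    ultimately have "(\<Sum>i\<in>I. ?c i j) \<le> 1" using bessel_inequality[OF f, of "g j"] by simp
    moreover have "(\<Sum>i\<in>I. ?c i j) \<ge> 0" by (simp add: sum_nonneg)
    ultimately show "(ev j - t) * (\<Sum>i\<in>I. ?c i j) \<le> max 0 (ev j - t)"
      using mult_left_mono[of "\<Sum>i\<in>I. ?c i j" 1 "ev j - t"]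
        mult_nonpos_nonneg[of "ev j - t" "\<Sum>i\<in>I. ?c i j"]
      by (cases "ev j \<ge> t") (simp_all add: max_def)
  qed
  finally show ?thesis .
qed

lemma laplacian_energy_ge:
  assumes "orthonormal_on (pverts G) I f" "finite I"
  shows "laplacian_energy G \<ge> 2 * (\<Sum>i\<in>I. dirichlet (parcs G) (f i) (f i) - avg_degree G)"
  using orthonormal_family_le[OF assms, of "avg_degree G"] by (simp add: laplacian_energy_max)

text \<open>\<open>h\<close> is the row of the Laplacian at \<open>u\<close>. Pairing with it
  evaluates the Laplacian at \<open>u\<close>, so \<open>ev i * g i u\<close> is the coefficient of
  \<open>h\<close> along \<open>g i\<close>, and Bessel bounds the sum by the squared norm of the
  row.\<close>

lemma eigenvectors_at_vertex:
  assumes "u \<in> pverts G" "I \<subseteq> {..<graph_order G}"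
  shows "(\<Sum>i\<in>I. (ev i * g i u)\<^sup>2) \<le> (card {y. (u, y) \<in> parcs G})\<^sup>2 + card {y. (u, y) \<in> parcs G}"
proof -
  have fin: "finite I" using assms(2) finite_subset by blast
  define N where "N = {y. (u, y) \<in> parcs G}"
  have N: "finite N" "N \<subseteq> pverts G" "u \<notin> N"
    using simps finite_subset[OF _ simps(1), of N] by (auto simp: N_def)
  define h where "h x = (if x = u then real (card N) else if x \<in> N then - 1 else 0)" for x
  have on: "orthonormal_on (pverts G) I g"
    by (rule orthonormal_on_subset[OF orthonormal assms(2)])
  have split: "pverts G = insert u (N \<union> (pverts G - insert u N))" using N assms by auto
  have fv: "finite (pverts G - insert u N)" using simps(1) by simp
  have gh: "inner_on (pverts G) f h = laplacian (parcs G) f u" for f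
  proof -
    have "inner_on (pverts G) f h = f u * card N + (\<Sum>x\<in>N. f x * h x)
        + (\<Sum>x\<in>pverts G - insert u N. f x * h x)"
      unfolding inner_on_def by (subst split, subst sum.insert, use N fv in simp, use N in simp)
        (subst sum.union_disjoint, use N fv in \<open>auto simp: h_def\<close>)
    also have "(\<Sum>x\<in>N. f x * h x) = (\<Sum>x\<in>N. - f x)"
      by (rule sum.cong) (use N in \<open>auto simp: h_def\<close>)
    also have "(\<Sum>x\<in>pverts G - insert u N. f x * h x) = 0"
      by (rule sum.neutral) (auto simp: h_def)
    finally show ?thesis by (simp add: laplacian_def N_def[symmetric] sum_subtractf sum_negf)
  qed
  have "(\<Sum>i\<in>I. (ev i * g i u)\<^sup>2) = (\<Sum>i\<in>I. (inner_on (pverts G) (g i) h)\<^sup>2)"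
    by (rule sum.cong) (use assms in \<open>auto simp: gh eigen\<close>)
  also have "\<dots> \<le> inner_on (pverts G) h h" by (rule bessel_inequality[OF on fin])
  also have "\<dots> = (\<Sum>y\<in>N. h u - h y)" by (simp add: gh laplacian_def N_def[symmetric])
  also have "\<dots> = (\<Sum>y\<in>N. real (card N) + 1)" by (rule sum.cong) (use N in \<open>auto simp: h_def\<close>)
  also have "\<dots> = (card N)\<^sup>2 + card N" by (simp add: power2_eq_square algebra_simps)
  finally show "(\<Sum>i\<in>I. (ev i * g i u)\<^sup>2) \<le> (card {y. (u, y) \<in> parcs G})\<^sup>2 + card {y. (u, y) \<in> parcs G}"
    by (simp add: N_def)
qed

lemma size_filter_spectrum:
  "size {#\<mu> \<in># laplacian_spectrum G. \<mu> \<ge> t#} = card {i. i < graph_order G \<and> ev i \<ge> t}"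
proof -
  have "size {#\<mu> \<in># laplacian_spectrum G. \<mu> \<ge> t#} = length (filter (\<lambda>\<mu>. \<mu> \<ge> t) (map ev [0..<graph_order G]))"
    unfolding spectrum by (metis mset_filter size_mset)
  also have "\<dots> = card {i. i < graph_order G \<and> ev i \<ge> t}"
    by (subst length_filter_conv_card) (auto intro: arg_cong[where f=card])
  finally show ?thesis .
qed

lemma laplacian_energy_filter:
  "laplacian_energy G = 2 * (\<Sum>i | i < graph_order G \<and> ev i \<ge> avg_degree G. ev i - avg_degree G)"
proof -
  have "{i. i < graph_order G \<and> ev i \<ge> avg_degree G} = {i\<in>{..<graph_order G}. ev i \<ge> avg_degree G}"
    by auto
  then show ?thesis unfolding laplacian_energy_max
    by (simp only:) (subst sum.inter_filter, auto intro!: sum.cong)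
qed

text \<open>Half of the energy is also the total shortfall of the eigenvalues below the average
  degree, and none falls short by more than that average because eigenvalues are nonnegative. Read
  backwards, a large energy limits the number of eigenvalues above the average.\<close>

lemma laplacian_energy_le:
  "laplacian_energy G \<le> 2 * (real (graph_order G)
     - real (size {#\<mu> \<in># laplacian_spectrum G. \<mu> \<ge> avg_degree G#})) * avg_degree G"
proof -
  let ?n = "graph_order G" and ?d = "avg_degree G"
  let ?S = "{i. i < ?n \<and> ev i \<ge> ?d}"
  have d: "?d \<ge> 0" by (simp add: avg_degree_def)
  have "(\<Sum>i<?n. ev i - ?d) = (\<Sum>i\<in>?S. ev i - ?d) + (\<Sum>i\<in>{..<?n} - ?S. ev i - ?d)"
    by (subst sum.subset_diff[of ?S]) auto
  moreover have "(\<Sum>i\<in>{..<?n} - ?S. ev i - ?d) \<ge> (\<Sum>i\<in>{..<?n} - ?S. - ?d)"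
    by (rule sum_mono) (auto simp: ev_nonneg)
  moreover have "card ({..<?n} - ?S) = ?n - card ?S" "card ?S \<le> ?n"
    using card_Diff_subset[of ?S "{..<?n}"] card_mono[of "{..<?n}" ?S] by auto
  ultimately show ?thesis
    unfolding laplacian_energy_filter size_filter_spectrum sum_ev_minus_avg
    by (simp add: of_nat_diff algebra_simps)
qed

end

lemma laplacian_eigenbasis_exists:
  assumes "pair_graph G"
  shows "\<exists>g ev. laplacian_eigenbasis G g ev"
  using orthonormal_laplacian_eigenfunctions[OF assms] assms unfolding laplacian_eigenbasis_def by blast

section \<open>Joining two graphs by an edge\<close>

lemma sum_mult_squared_le:
  fixes a b :: "'i \<Rightarrow> real"
  shows "(\<Sum>i\<in>I. a i * b i)\<^sup>2 \<le> (\<Sum>i\<in>I. (a i)\<^sup>2) * (\<Sum>i\<in>I. (b i)\<^sup>2)"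
proof -
  have "\<bar>\<Sum>i\<in>I. a i * b i\<bar> \<le> (\<Sum>i\<in>I. \<bar>a i\<bar> * \<bar>b i\<bar>)"
    using sum_abs[of "\<lambda>i. a i * b i" I] by (simp add: abs_mult)
  also have "\<dots> \<le> L2_set a I * L2_set b I" by (rule L2_set_mult_ineq)
  finally have "\<bar>\<Sum>i\<in>I. a i * b i\<bar>\<^sup>2 \<le> (L2_set a I * L2_set b I)\<^sup>2" by (rule power_mono) simp
  then show ?thesis by (simp add: L2_set_def power_mult_distrib sum_nonneg)
qed


section \<open>The residual of a vertex indicator after projection to chosen eigenvectors\<close>

context laplacian_eigenbasis
begin

definition residual :: "'a \<Rightarrow> nat set \<Rightarrow> 'a \<Rightarrow> real" where
  "residual u I x = (if x = u then 1 else 0) - (\<Sum>i\<in>I. g i u * g i x)"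

context
  fixes u I
  assumes u: "u \<in> pverts G" and I: "I \<subseteq> {..<graph_order G}"
begin

lemma finite_I: "finite I"
  using I finite_subset by blast

lemma inner_on_unit: "inner_on (pverts G) f (\<lambda>x. if x = u then 1 else 0) = f u"
proof -
  have "inner_on (pverts G) f (\<lambda>x. if x = u then 1 else 0) = (\<Sum>x\<in>pverts G. if x = u then f u else 0)"
    unfolding inner_on_def by (rule sum.cong) auto
  then show ?thesis using u simps(1) by simp
qed

lemma residual_eq:
  "residual u I = (\<lambda>x. (if x = u then 1 else 0)
     - (\<Sum>i\<in>I. inner_on (pverts G) (g i) (\<lambda>x. if x = u then 1 else 0) * g i x))"
  by (simp add: residual_def fun_eq_iff inner_on_unit)

lemma inner_on_residual: "i \<in> I \<Longrightarrow> inner_on (pverts G) (g i) (residual u I) = 0"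
  unfolding residual_eq
  by (rule orthonormal_projection(1)[OF orthonormal_on_subset[OF orthonormal I] finite_I])

lemma inner_on_residual_self: "inner_on (pverts G) (residual u I) (residual u I) = 1 - (\<Sum>i\<in>I. (g i u)\<^sup>2)"
  unfolding residual_eq orthonormal_projection(2)[OF orthonormal_on_subset[OF orthonormal I] finite_I]
  by (simp add: inner_on_unit)

lemma residual_at: "residual u I u = 1 - (\<Sum>i\<in>I. (g i u)\<^sup>2)"
  by (simp add: residual_def power2_eq_square)

lemma residual_support: "x \<notin> pverts G \<Longrightarrow> residual u I x = 0"
  using u by (auto simp: residual_def support)

lemma inner_on_residual_other:
  assumes "i < graph_order G" "i \<notin> I"
  shows "inner_on (pverts G) (g i) (residual u I) = g i u"
proof -
  have "inner_on (pverts G) (g i) (\<lambda>x. \<Sum>j\<in>I. g j u * g j x) = (\<Sum>j\<in>I. g j u * inner_on (pverts G) (g j) (g i))"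
    by (subst inner_on_commute, subst inner_on_sum_left) simp
  also have "\<dots> = 0"
  proof (rule sum.neutral, rule ballI)
    fix j assume "j \<in> I"
    then have "inner_on (pverts G) (g j) (g i) = 0"
      using orthonormal_onD[OF orthonormal, of j i] assms I by auto
    then show "g j u * inner_on (pverts G) (g j) (g i) = 0" by simp
  qed
  finally show ?thesis
    using inner_on_unit[of "g i"] inner_on_diff_right[of "pverts G" "g i"]
    by (simp add: residual_def[abs_def])
qed

lemma dirichlet_unit:
  "dirichlet (parcs G) (\<lambda>x. if x = u then 1 else 0) (\<lambda>x. if x = u then 1 else 0)
    = real (card {y. (u, y) \<in> parcs G})"
proof -
  have "dirichlet (parcs G) (\<lambda>x. if x = u then 1 else 0) (\<lambda>x. if x = u then 1 else 0)
      = laplacian (parcs G) (\<lambda>x. if x = u then 1 else 0) u"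
    unfolding inner_on_laplacian[OF simps(1,3,4), symmetric]
    by (subst inner_on_commute) (rule inner_on_unit)
  also have "\<dots> = (\<Sum>y | (u, y) \<in> parcs G. 1)"
    unfolding laplacian_def by (rule sum.cong) (use simps(5) in auto)
  finally show ?thesis by simp
qed

text \<open>The residual keeps exactly the coefficients of the indicator outside \<open>I\<close>.
  The full indicator has the degree as its form, and the part carried by \<open>I\<close> is
  subtracted.\<close>

lemma dirichlet_residual:
  "dirichlet (parcs G) (residual u I) (residual u I)
    = real (card {y. (u, y) \<in> parcs G}) - (\<Sum>i\<in>I. ev i * (g i u)\<^sup>2)"
proof -
  have "dirichlet (parcs G) (residual u I) (residual u I)
      = (\<Sum>i<graph_order G. if i \<in> I then 0 else ev i * (g i u)\<^sup>2)"
    unfolding dirichlet_expansion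
    by (rule sum.cong) (auto simp: inner_on_residual inner_on_residual_other)
  also have "\<dots> = (\<Sum>i\<in>{..<graph_order G} - I. ev i * (g i u)\<^sup>2)"
    by (rule sum.mono_neutral_cong_right) auto
  also have "\<dots> = (\<Sum>i<graph_order G. ev i * (g i u)\<^sup>2) - (\<Sum>i\<in>I. ev i * (g i u)\<^sup>2)"
    by (rule sum_diff) (use I in auto)
  also have "(\<Sum>i<graph_order G. ev i * (g i u)\<^sup>2) = real (card {y. (u, y) \<in> parcs G})"
    unfolding dirichlet_unit[symmetric] dirichlet_expansion by (simp add: inner_on_unit)
  finally show ?thesis .
qed

text \<open>Cauchy-Schwarz with the eigenvalues placed entirely in one factor, which is then
  controlled by the Laplacian row at \<open>u\<close> rather than by the largest eigenvalue.\<close>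

lemma weighted_mass_squared_le:
  "(\<Sum>i\<in>I. ev i * (g i u)\<^sup>2)\<^sup>2 \<le> (\<Sum>i\<in>I. (g i u)\<^sup>2) *
    ((card {y. (u, y) \<in> parcs G})\<^sup>2 + card {y. (u, y) \<in> parcs G})"
proof -
  have "(\<Sum>i\<in>I. ev i * (g i u)\<^sup>2)\<^sup>2 = (\<Sum>i\<in>I. g i u * (ev i * g i u))\<^sup>2"
    by (simp add: power2_eq_square mult_ac)
  also have "\<dots> \<le> (\<Sum>i\<in>I. (g i u)\<^sup>2) * (\<Sum>i\<in>I. (ev i * g i u)\<^sup>2)"
    by (rule sum_mult_squared_le)
  also have "\<dots> \<le> (\<Sum>i\<in>I. (g i u)\<^sup>2) *
    ((card {y. (u, y) \<in> parcs G})\<^sup>2 + card {y. (u, y) \<in> parcs G})"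
    using eigenvectors_at_vertex[OF u I] by (intro mult_left_mono sum_nonneg) auto
  finally show ?thesis .
qed

end

lemma laplacian_energy_ge_insert:
  assumes f: "orthonormal_on (pverts G) I f" "finite I"
    and w: "\<And>i. i \<in> I \<Longrightarrow> inner_on (pverts G) (f i) w = 0" "inner_on (pverts G) w w > 0"
  shows "laplacian_energy G \<ge> 2 * ((\<Sum>i\<in>I. dirichlet (parcs G) (f i) (f i) - avg_degree G)
    + dirichlet (parcs G) w w / inner_on (pverts G) w w - avg_degree G)"
proof -
  define c where "c = 1 / sqrt (inner_on (pverts G) w w)"
  have c: "c * c = 1 / inner_on (pverts G) w w" using w(2) by (simp add: c_def)
  \<comment> \<open>\<open>None\<close> indexes the additional normalized vector.\<close>
  define F where "F k = (case k of None \<Rightarrow> (\<lambda>x. c * w x) | Some i \<Rightarrow> f i)" for k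
  have sc: "inner_on (pverts G) (\<lambda>x. c * w x) h = c * inner_on (pverts G) w h" for h
    by (simp add: inner_on_def sum_distrib_left mult.assoc)
  have w': "inner_on (pverts G) w (f i) = 0" if "i \<in> I" for i
    using w(1)[OF that] by (simp add: inner_on_commute)
  have "orthonormal_on (pverts G) (insert None (Some ` I)) F"
    using w f(1) w' c
    by (auto simp: orthonormal_on_def F_def sc inner_on_scale_right mult.assoc[symmetric])
  from laplacian_energy_ge[OF this] f(2)
  have "laplacian_energy G \<ge> 2 * (\<Sum>i\<in>insert None (Some ` I). dirichlet (parcs G) (F i) (F i) - avg_degree G)"
    by simp
  moreover have "dirichlet (parcs G) (F None) (F None) = dirichlet (parcs G) w w / inner_on (pverts G) w w"
  proof -
    have "dirichlet (parcs G) (F None) (F None) = c * c * dirichlet (parcs G) w w"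
      by (simp add: F_def dirichlet_def sum_distrib_left case_prod_beta algebra_simps)
    then show ?thesis by (simp add: c)
  qed
  moreover have "(\<Sum>i\<in>Some ` I. dirichlet (parcs G) (F i) (F i) - avg_degree G)
      = (\<Sum>i\<in>I. dirichlet (parcs G) (f i) (f i) - avg_degree G)"
    by (subst sum.reindex) (auto simp: F_def)
  ultimately show ?thesis using f(2) by (subst (asm) sum.insert) auto
qed

end

text \<open>With s the root of \<open>p\<close>, the quotient is at least 2 (1 - s) / (2 - s^2).
  This decreases in s, and at \<open>p = 1/2\<close> it is about 0.3905, which explains the
  constant.\<close>

lemma coupling_gain:
  fixes p q D t :: real
  assumes p: "0 \<le> p" "p \<le> 1/2" and q: "q\<^sup>2 \<le> p * D\<^sup>2" and D: "D \<ge> 2"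
  shows "(D - q) / (2 - p) \<ge> 39/100"
proof -
  define s where "s = sqrt p"
  have s: "s\<^sup>2 = p" "s \<ge> 0" using p by (simp_all add: s_def)
  have "q \<le> s * D"
    by (rule power2_le_imp_le) (use q s D in \<open>simp_all add: power_mult_distrib\<close>)
  then have Dq: "D - q \<ge> D * (1 - s)" by (simp add: algebra_simps)
  \<comment> \<open>Slightly more than the square root of 1/2.\<close>
  have s1: "s \<le> 7072/10000"
    by (rule power2_le_imp_le) (use s p in \<open>simp_all add: power2_eq_square\<close>)
  have "2 * (1 - s) \<le> D * (1 - s)" using s1 D by (intro mult_right_mono) auto
  with Dq have "D - q \<ge> 2 - 2 * s" by (simp add: algebra_simps)
  \<comment> \<open>The factors come from approximate roots of
    \<open>39/100 * s\<^sup>2 - 2 * s + 122/100\<close>, the quadratic that has to be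
    nonnegative.\<close>
  moreover have "0 \<le> (7072/10000 - s) * (44/10 - s)" using s1 by (intro mult_nonneg_nonneg) auto
  then have "s\<^sup>2 \<ge> 51072/10000 * s - 311168/100000"
    by (simp add: power2_eq_square field_simps)
  ultimately have "D - q \<ge> 39/100 * (2 - p)" unfolding s(1)[symmetric] using s1 by simp
  then show ?thesis using p by (simp add: field_simps)
qed


text \<open>Merges the Cauchy-Schwarz bounds at the two ends of the edge; the cross term is handled
  by the arithmetic-geometric mean inequality for \<open>p1 * R2\<close> and
  \<open>p2 * R1\<close>.\<close>

lemma sum_squared_le:
  fixes q1 q2 p1 p2 R1 R2 :: real
  assumes "q1\<^sup>2 \<le> p1 * R1" "q2\<^sup>2 \<le> p2 * R2" "p1 \<ge> 0" "p2 \<ge> 0" "R1 \<ge> 0" "R2 \<ge> 0"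
  shows "(q1 + q2)\<^sup>2 \<le> (p1 + p2) * (R1 + R2)"
proof -
  have "(q1 * q2)\<^sup>2 \<le> (p1 * R1) * (p2 * R2)"
    unfolding power_mult_distrib using assms by (intro mult_mono) auto
  also have "\<dots> = (p1 * R2) * (p2 * R1)" by simp
  also have "\<dots> \<le> ((p1 * R2 + p2 * R1) / 2)\<^sup>2"
    using zero_le_power2[of "p1 * R2 - p2 * R1"] by (simp add: power2_eq_square field_simps)
  finally have "q1 * q2 \<le> (p1 * R2 + p2 * R1) / 2"
    by (rule power2_le_imp_le) (use assms in simp)
  then show ?thesis using assms(1,2) by (simp add: power2_eq_square algebra_simps)
qed

section \<open>Test families on the joined graph\<close>

context
  fixes T1 T2 T :: "'a pair_pre_digraph" and u v :: 'a and g h :: "nat \<Rightarrow> 'a \<Rightarrow> real" and ev fv :: "nat \<Rightarrow> real"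
    and I J :: "nat set" and g' :: "nat \<Rightarrow> 'a \<Rightarrow> real" and ev'
  assumes G1: "laplacian_eigenbasis T1 g ev" and G2: "laplacian_eigenbasis T2 h fv"
    and GT: "laplacian_eigenbasis T g' ev'"
    and disjoint: "pverts T1 \<inter> pverts T2 = {}"
    and uv: "u \<in> pverts T1" "v \<in> pverts T2"
    and T: "T = join_by_edge T1 u v T2"
    and I: "I \<subseteq> {..<graph_order T1}" and J: "J \<subseteq> {..<graph_order T2}"
begin

interpretation G1: laplacian_eigenbasis T1 g ev by (rule G1)
interpretation G2: laplacian_eigenbasis T2 h fv by (rule G2)
interpretation GT: laplacian_eigenbasis T g' ev' by (rule GT)

lemma pverts_T: "pverts T = pverts T1 \<union> pverts T2"
  by (simp add: T join_by_edge_def)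

lemma inner_on_join: "inner_on (pverts T) f f' = inner_on (pverts T1) f f' + inner_on (pverts T2) f f'"
  unfolding inner_on_def pverts_T by (rule sum.union_disjoint) (use G1.simps G2.simps disjoint in auto)

lemma dirichlet_join:
  "dirichlet (parcs T) f f = dirichlet (parcs T1) f f + dirichlet (parcs T2) f f + (f u - f v)\<^sup>2"
proof -
  have ne: "u \<noteq> v" using disjoint uv by auto
  have "parcs T = (parcs T1 \<union> parcs T2) \<union> {(u, v), (v, u)}"
    by (simp add: T join_by_edge_def)
  moreover have "parcs T1 \<inter> parcs T2 = {}" "(parcs T1 \<union> parcs T2) \<inter> {(u, v), (v, u)} = {}"
    using G1.simps(3) G2.simps(3) disjoint uv by auto
  ultimately show ?thesis using ne
    by (simp add: dirichlet_self sum.union_disjoint G1.simps G2.simps add_divide_distrib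
        power2_commute[of "f v"])
qed

definition joint :: "nat + nat \<Rightarrow> 'a \<Rightarrow> real" where
  "joint k = (case k of Inl i \<Rightarrow> g i | Inr j \<Rightarrow> h j)"

lemma zero_outside:
  "x \<in> pverts T2 \<Longrightarrow> g i x = 0" "x \<in> pverts T1 \<Longrightarrow> h j x = 0"
  using G1.support G2.support disjoint by blast+

lemma orthonormal_joint: "orthonormal_on (pverts T) (I <+> J) joint"
proof -
  have "inner_on (pverts T) (g i) (g i') = (if i = i' then 1 else 0)" if "i \<in> I" "i' \<in> I" for i i'
    using orthonormal_onD[OF orthonormal_on_subset[OF G1.orthonormal I] that]
    by (auto simp: inner_on_join inner_on_zero zero_outside)
  moreover have "inner_on (pverts T) (h i) (h i') = (if i = i' then 1 else 0)" if "i \<in> J" "i' \<in> J" for i i'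
    using orthonormal_onD[OF orthonormal_on_subset[OF G2.orthonormal J] that]
    by (auto simp: inner_on_join inner_on_zero zero_outside)
  moreover have "inner_on (pverts T) (g i) (h j) = 0" for i j
    unfolding inner_on_join by (simp add: inner_on_zero zero_outside inner_on_commute[of "pverts T1" _ "h j"])
  moreover have "inner_on (pverts T) (h j) (g i) = 0" for i j
    unfolding inner_on_join by (simp add: inner_on_zero zero_outside inner_on_commute[of "pverts T2" _ "g i"])
  ultimately show ?thesis by (auto simp: orthonormal_on_def joint_def split: if_splits)
qed

lemma finite_IJ: "finite I" "finite J"
  using I J finite_subset by blast+

abbreviation "mass \<equiv> (\<Sum>i\<in>I. (g i u)\<^sup>2) + (\<Sum>j\<in>J. (h j v)\<^sup>2)"
abbreviation "wmass \<equiv> (\<Sum>i\<in>I. ev i * (g i u)\<^sup>2) + (\<Sum>j\<in>J. fv j * (h j v)\<^sup>2)"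
abbreviation "base t \<equiv> (\<Sum>i\<in>I. ev i - t) + (\<Sum>j\<in>J. fv j - t)"

text \<open>Each eigenvector extended by zero vanishes at one end of the new edge, so the edge adds
  the square of its value at the other end.\<close>

lemma sum_joint:
  "(\<Sum>k\<in>I <+> J. dirichlet (parcs T) (joint k) (joint k) - t) = base t + mass"
proof -
  have "dirichlet (parcs T) (g i) (g i) = ev i + (g i u)\<^sup>2" if "i \<in> I" for i
    using G1.ev_eq[of i] that I uv
      dirichlet_zero[of "pverts T2" "g i" "parcs T2", OF zero_outside(1) G2.simps(3)]
    by (auto simp: dirichlet_join zero_outside)
  moreover have "dirichlet (parcs T) (h j) (h j) = fv j + (h j v)\<^sup>2" if "j \<in> J" for j
    using G2.ev_eq[of j] that J uv
      dirichlet_zero[of "pverts T1" "h j" "parcs T1", OF zero_outside(2) G1.simps(3)]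
    by (auto simp: dirichlet_join zero_outside)
  ultimately show ?thesis
    by (simp add: sum.Plus finite_IJ joint_def sum.distrib sum_subtractf card_Plus algebra_simps)
qed

lemma join_energy_plain: "laplacian_energy T \<ge> 2 * (base (avg_degree T) + mass)"
  using GT.laplacian_energy_ge[OF orthonormal_joint] finite_IJ by (simp add: sum_joint)

text \<open>The residual of e_u - e_v splits into the residuals on the two halves. Its squared norm
  and its jump across the edge both equal \<open>2 - mass\<close>, so the edge adds
  \<open>2 - mass\<close> to its Rayleigh quotient; together with the \<open>mass\<close> gained by
  the family this is exactly 2.\<close>

lemma join_energy_coupled:
  assumes "mass < 2"
  shows "laplacian_energy T \<ge> 2 * (base (avg_degree T) + 2 - avg_degree T
    + (real (card {y. (u, y) \<in> parcs T1}) + real (card {y. (v, y) \<in> parcs T2}) - wmass) / (2 - mass))"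
proof -
  let ?a = "G1.residual u I" and ?b = "G2.residual v J"
  define w where "w x = ?a x - ?b x" for x
  have wa: "w x = ?a x" if "x \<in> pverts T1" for x
    using that disjoint G2.residual_support[OF uv(2) J] by (auto simp: w_def)
  have wb: "w x = - ?b x" if "x \<in> pverts T2" for x
    using that disjoint G1.residual_support[OF uv(1) I] by (auto simp: w_def)
  have i1: "inner_on (pverts T1) f w = inner_on (pverts T1) f ?a" for f
    by (rule inner_on_cong) (auto simp: wa)
  have i2: "inner_on (pverts T2) f w = - inner_on (pverts T2) f ?b" for f
    by (simp add: inner_on_def wb sum_negf)
  have "inner_on (pverts T1) w w = inner_on (pverts T1) ?a ?a"
    by (rule inner_on_cong) (simp_all add: wa)
  moreover have "inner_on (pverts T2) w w = inner_on (pverts T2) ?b ?b"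
    by (simp add: inner_on_def wb)
  ultimately have ww: "inner_on (pverts T) w w = 2 - mass"
    using G1.inner_on_residual_self[OF uv(1) I] G2.inner_on_residual_self[OF uv(2) J]
    by (simp add: inner_on_join)
  have "inner_on (pverts T) (g i) w = 0" if "i \<in> I" for i
    using G1.inner_on_residual[OF uv(1) I that]
    by (simp add: inner_on_join i1 inner_on_zero zero_outside)
  moreover have "inner_on (pverts T) (h j) w = 0" if "j \<in> J" for j
    using G2.inner_on_residual[OF uv(2) J that]
    by (simp add: inner_on_join i2 inner_on_zero zero_outside)
  ultimately have orth: "inner_on (pverts T) (joint k) w = 0" if "k \<in> I <+> J" for k
    using that by (auto simp: joint_def)
  have "dirichlet (parcs T1) w w = dirichlet (parcs T1) ?a ?a"
    by (rule dirichlet_cong[OF _ G1.simps(3)]) (rule wa)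
  moreover have "dirichlet (parcs T2) w w = dirichlet (parcs T2) (\<lambda>x. - ?b x) (\<lambda>x. - ?b x)"
    by (rule dirichlet_cong[OF _ G2.simps(3)]) (rule wb)
  then have "dirichlet (parcs T2) w w = dirichlet (parcs T2) ?b ?b"
    by (simp add: dirichlet_self power2_commute)
  moreover have "w u - w v = 2 - mass"
    using G1.residual_at[OF uv(1) I] G2.residual_at[OF uv(2) J] uv by (simp add: wa wb)
  ultimately have dw: "dirichlet (parcs T) w w = real (card {y. (u, y) \<in> parcs T1})
      + real (card {y. (v, y) \<in> parcs T2}) - wmass + (2 - mass)\<^sup>2"
    by (simp add: dirichlet_join G1.dirichlet_residual[OF uv(1) I] G2.dirichlet_residual[OF uv(2) J])
  have "inner_on (pverts T) w w > 0" using ww assms by simp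
  note GT.laplacian_energy_ge_insert[OF orthonormal_joint _ orth this]
  then have "laplacian_energy T \<ge> 2 * (base (avg_degree T) + mass
      + dirichlet (parcs T) w w / (2 - mass) - avg_degree T)"
    using finite_IJ by (simp add: sum_joint ww)
  moreover have "dirichlet (parcs T) w w / (2 - mass) = (real (card {y. (u, y) \<in> parcs T1})
      + real (card {y. (v, y) \<in> parcs T2}) - wmass) / (2 - mass) + (2 - mass)"
    unfolding dw add_divide_distrib using assms by (simp add: power2_eq_square)
  ultimately show ?thesis by (simp add: algebra_simps)
qed

text \<open>
  Either the selected eigenvectors already see the new edge, or they nearly miss its endpoints
  and the edge contributes a further direction of its own.
\<close>

lemma join_energy_gain:
  assumes deg: "card {y. (u, y) \<in> parcs T1} \<ge> 1" "card {y. (v, y) \<in> parcs T2} \<ge> 1"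
  shows "laplacian_energy T \<ge> 2 * (base (avg_degree T) + min (1/2) (39/100 + (2 - avg_degree T)))"
proof (cases "mass \<le> 1/2")
  case False
  have "L \<ge> 2 * (b + min (1/2) x)" if "L \<ge> 2 * (b + m)" "\<not> m \<le> 1/2" for L b m x :: real
    using that min.cobounded1[of "1/2" x] by argo
  from this[OF join_energy_plain False] show ?thesis .
next
  case True
  let ?du = "card {y. (u, y) \<in> parcs T1}" and ?dv = "card {y. (v, y) \<in> parcs T2}"
  have "wmass\<^sup>2 \<le> mass * (((?du)\<^sup>2 + ?du) + ((?dv)\<^sup>2 + ?dv))"
    using sum_squared_le[OF G1.weighted_mass_squared_le[OF uv(1) I] G2.weighted_mass_squared_le[OF uv(2) J]]
    by (simp add: sum_nonneg)
  also have "\<dots> \<le> mass * (real ?du + real ?dv)\<^sup>2"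
  proof (rule mult_left_mono)
    \<comment> \<open>Since both degrees are positive, the squared norms of the two Laplacian rows
      together stay below the square of the degree sum.\<close>
    have "?du + ?dv \<le> 2 * ?du * ?dv"
    proof -
      have "?du * 1 \<le> ?du * ?dv" "1 * ?dv \<le> ?du * ?dv"
        using deg by (intro mult_le_mono; simp)+
      then show ?thesis unfolding mult.assoc by linarith
    qed
    then have "real (((?du)\<^sup>2 + ?du) + ((?dv)\<^sup>2 + ?dv)) \<le> real ((?du + ?dv)\<^sup>2)"
      unfolding of_nat_le_iff by (simp add: power2_sum)
    then show "real (((?du)\<^sup>2 + ?du) + ((?dv)\<^sup>2 + ?dv)) \<le> (real ?du + real ?dv)\<^sup>2" by simp
  qed (simp add: sum_nonneg)
  finally have "(real ?du + real ?dv - wmass) / (2 - mass) \<ge> 39/100"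
    by (intro coupling_gain) (use True deg in \<open>auto simp: sum_nonneg\<close>)
  moreover have "L \<ge> 2 * (b + min (1/2) (39/100 + (2 - d)))"
    if "r \<ge> 39/100" "L \<ge> 2 * (b + 2 - d + r)" for L b d r :: real
    using that min.cobounded2[of "1/2" "39/100 + (2 - d)"] by argo
  moreover have "mass < 2" using True by simp
  note join_energy_coupled[OF this]
  ultimately show ?thesis by blast
qed

end

section \<open>Trees and double stars\<close>

text \<open>Growth by leaves supplies the induction for counting edges, for finding neighbours and
  for classifying trees of small diameter.\<close>

inductive tree_arcs :: "'a set \<Rightarrow> ('a \<times> 'a) set \<Rightarrow> bool" where
  single: "tree_arcs {x} {}"
| leaf: "tree_arcs V E \<Longrightarrow> y \<in> V \<Longrightarrow> x \<notin> V \<Longrightarrow> tree_arcs (insert x V) (E \<union> {(x, y), (y, x)})"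

text \<open>A longest path starts at a leaf: by maximality all neighbours of its first vertex lie on
  it, and one at index 2 or later would close a cycle of length at least 3.\<close>

lemma acyclic_connected_leaf:
  assumes V: "finite V" "2 \<le> card V" and E: "E \<subseteq> V \<times> V" "sym E" "irrefl E"
    and conn: "\<And>a b. a \<in> V \<Longrightarrow> b \<in> V \<Longrightarrow> (a, b) \<in> E\<^sup>*"
    and acyc: "\<And>xs. distinct xs \<Longrightarrow> 3 \<le> length xs \<Longrightarrow> successively (\<lambda>a b. (a, b) \<in> E) xs \<Longrightarrow>
      (last xs, hd xs) \<notin> E"
  shows "\<exists>x y. x \<in> V \<and> (x, y) \<in> E \<and> (\<forall>z. (x, z) \<in> E \<longrightarrow> z = y)"
proof -
  let ?R = "\<lambda>a b. (a, b) \<in> E"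
  let ?P = "{xs. distinct xs \<and> xs \<noteq> [] \<and> set xs \<subseteq> V \<and> successively ?R xs}"
  have "\<not> card V \<le> Suc 0" using V(2) by simp
  then obtain a b where ab: "a \<in> V" "b \<in> V" "a \<noteq> b"
    unfolding card_le_Suc0_iff_eq[OF V(1)] by blast
  then obtain c where c: "(a, c) \<in> E" using conn[of a b] by (auto elim: converse_rtranclE)
  then have path2: "[a, c] \<in> ?P" using E by (auto simp: irrefl_def)
  have bound: "\<forall>ys. ys \<in> ?P \<longrightarrow> length ys < Suc (card V)"
    using V(1) by (auto simp: less_Suc_eq_le distinct_card[symmetric] intro!: card_mono)
  obtain xs where xs: "xs \<in> ?P" "\<And>ys. ys \<in> ?P \<Longrightarrow> length ys \<le> length xs"
    using ex_has_greatest_nat[of "\<lambda>ys. ys \<in> ?P", OF path2 bound] by blast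
  have "length xs \<ge> 2" using xs(2)[OF path2] by simp
  then obtain x y zs where xyz: "xs = x # y # zs" by (cases xs rule: remdups_adj.cases) auto
  have "z = y" if z: "(x, z) \<in> E" for z
  proof -
    have zV: "z \<in> V" "z \<noteq> x" using z E by (auto simp: irrefl_def)
    have "z \<in> set xs"
    proof (rule ccontr)
      assume "z \<notin> set xs"
      moreover have "(z, hd xs) \<in> E" using z E(2) by (auto simp: xyz dest: symD)
      ultimately have "z # xs \<in> ?P" using xs(1) zV(1) by (simp add: successively_Cons)
      then show False using xs(2)[of "z # xs"] by simp
    qed
    then obtain i where i: "i < length xs" "xs ! i = z" by (auto simp: in_set_conv_nth)
    have "i \<noteq> 0" by (rule notI) (use i zV in \<open>simp add: xyz\<close>)
    moreover have "\<not> i \<ge> 2"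
    proof
      assume i2: "i \<ge> 2"
      let ?c = "take (Suc i) xs"
      have "xs = ?c @ drop (Suc i) xs" by simp
      then have "successively ?R ?c"
        using xs(1) successively_append_iff[of ?R ?c "drop (Suc i) xs"] by simp
      moreover have "last ?c = z" using i by (simp add: take_Suc_conv_app_nth)
      moreover have "hd ?c = x" by (simp add: xyz)
      ultimately show False using acyc[of ?c] xs(1) i i2 z E(2) by (auto dest: symD)
    qed
    ultimately have "i = 1" by simp
    then show ?thesis using i by (simp add: xyz)
  qed
  moreover have "x \<in> V" "(x, y) \<in> E" using xs(1) by (auto simp: xyz)
  ultimately show ?thesis by blast
qed

lemma acyclic_connected_tree_arcs:
  assumes "finite V" "V \<noteq> {}" "E \<subseteq> V \<times> V" "sym E" "irrefl E"
    and "\<And>a b. a \<in> V \<Longrightarrow> b \<in> V \<Longrightarrow> (a, b) \<in> E\<^sup>*"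
    and "\<And>xs. distinct xs \<Longrightarrow> 3 \<le> length xs \<Longrightarrow> successively (\<lambda>a b. (a, b) \<in> E) xs \<Longrightarrow>
      (last xs, hd xs) \<notin> E"
  shows "tree_arcs V E"
  using assms
proof (induction "card V" arbitrary: V E rule: less_induct)
  case less
  note E = less.prems(3-5)
  show ?case
  proof (cases "card V \<ge> 2")
    case False
    then have "card V = 1" using card_gt_0_iff[of V] less.prems(1,2) by simp
    then obtain a where a: "V = {a}" by (auto simp: card_1_singleton_iff)
    then have "E = {}" using E by (auto simp: irrefl_def)
    then show ?thesis using a single by simp
  next
    case True
    obtain x y where xy: "x \<in> V" "(x, y) \<in> E" "\<And>z. (x, z) \<in> E \<Longrightarrow> z = y"
    proof -
      have "\<exists>x y. x \<in> V \<and> (x, y) \<in> E \<and> (\<forall>z. (x, z) \<in> E \<longrightarrow> z = y)"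
        by (rule acyclic_connected_leaf[OF less.prems(1) True less.prems(3-5)]) (fact less.prems)+
      then show thesis using that by blast
    qed
    have ne: "x \<noteq> y" "y \<in> V" using xy(2) E(1,3) by (auto simp: irrefl_def)
    define V' where "V' = V - {x}"
    define E' where "E' = E \<inter> (V' \<times> V')"
    \<comment> \<open>Folding the leaf onto its neighbour maps walks to walks that avoid the leaf,
      so the remaining graph stays connected.\<close>
    define \<phi> where "\<phi> z = (if z = x then y else z)" for z
    have yx: "(y, x) \<in> E" using xy(2) E(2) by (rule symD[rotated])
    have E_eq: "E = E' \<union> {(x, y), (y, x)}"
    proof
      show "E \<subseteq> E' \<union> {(x, y), (y, x)}"
      proof (rule subrelI)
        fix a b assume ab: "(a, b) \<in> E"
        consider "a = x" | "a \<noteq> x" "b = x" | "a \<noteq> x" "b \<noteq> x" by blast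
        then show "(a, b) \<in> E' \<union> {(x, y), (y, x)}"
        proof cases
          case 1
          then show ?thesis using xy(3) ab by simp
        next
          case 2
          then show ?thesis using xy(3)[of a] symD[OF E(2) ab] by simp
        next
          case 3
          then show ?thesis using ab E(1) by (auto simp: E'_def V'_def)
        qed
      qed
    qed (use xy(2) yx in \<open>auto simp: E'_def\<close>)
    have V_eq: "V = insert x V'" using xy(1) by (auto simp: V'_def)
    have step: "(\<phi> a, \<phi> b) \<in> E'\<^sup>*" if "(a, b) \<in> E\<^sup>*" for a b
      using that
    proof (induction rule: rtrancl_induct)
      case (step b c)
      have "(\<phi> b, \<phi> c) \<in> E'\<^sup>*"
      proof (cases "b = x \<or> c = x")
        case True
        then have "\<phi> b = \<phi> c" using step(2) xy(3)[of c] xy(3)[of b] symD[OF E(2), of b x]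
          by (auto simp: \<phi>_def)
        then show ?thesis by simp
      next
        case False
        then have "(\<phi> b, \<phi> c) \<in> E'" using step(2) E(1) by (auto simp: \<phi>_def E'_def V'_def)
        then show ?thesis by simp
      qed
      then show ?case using step(3) by simp
    qed simp
    have "tree_arcs V' E'"
    proof (rule less.hyps)
      show "card V' < card V" unfolding V'_def using xy(1) less.prems(1) by (meson card_Diff1_less)
      show "finite V'" "V' \<noteq> {}" using less.prems(1) ne by (auto simp: V'_def)
      show "E' \<subseteq> V' \<times> V'" by (auto simp: E'_def)
      show "sym E'" using E(2) by (auto simp: E'_def sym_def)
      show "irrefl E'" using E(3) by (auto simp: E'_def irrefl_def)
      show "(a, b) \<in> E'\<^sup>*" if "a \<in> V'" "b \<in> V'" for a b
        using step[OF less.prems(6), of a b] that by (auto simp: V'_def \<phi>_def)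
      show "(last xs, hd xs) \<notin> E'"
        if "distinct xs" "3 \<le> length xs" "successively (\<lambda>a b. (a, b) \<in> E') xs" for xs
      proof -
        have "successively (\<lambda>a b. (a, b) \<in> E) xs"
          by (rule successively_mono[OF that(3)]) (simp add: E'_def)
        then show ?thesis using less.prems(7)[OF that(1,2)] by (simp add: E'_def)
      qed
    qed
    then show ?thesis unfolding V_eq E_eq by (rule leaf) (use ne in \<open>auto simp: V'_def\<close>)
  qed
qed

text \<open>Pairing a vertex list with its shift yields the arc list of the corresponding walk; with
  \<open>z = x\<close> this turns a closed vertex path into a cycle in the sense of arc
  walks.\<close>

lemma pcas_zip:
  "pcas x (zip (x # xs) (xs @ [z])) z" 
proof (induction xs arbitrary: x)
  case (Cons a xs)
  then show ?case by (cases xs) auto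
qed simp

lemma pawalk_verts_zip: "pawalk_verts x (zip (x # xs) (xs @ [z])) = x # xs @ [z]"
proof (induction xs arbitrary: x)
  case (Cons a xs)
  then show ?case by (cases xs) auto
qed simp

lemma set_zip_successively:
  "successively R (x # xs) \<Longrightarrow> R (last (x # xs)) z \<Longrightarrow> (a, b) \<in> set (zip (x # xs) (xs @ [z])) \<Longrightarrow> R a b"
  by (induction xs arbitrary: x) auto

lemma undirected_tree_tree_arcs:
  assumes G: "undirected_tree G"
  shows "tree_arcs (pverts G) (parcs G)"
proof -
  have pg: "pair_graph G" and conn: "Digraph_Component.connected (with_proj G)"
    and acyc: "\<And>p. pre_digraph.cycle (with_proj G) p \<Longrightarrow> length p < 3"
    using G unfolding undirected_tree_def by (auto simp: not_le)
  note S = pair_graph_simps[OF pg]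
  interpret pair_graph G by (rule pg)
  have sc: "strongly_connected (with_proj G)"
    by (rule symmetric_connected_imp_strongly_connected[OF pair_sym_arcs conn])
  show ?thesis
  proof (rule acyclic_connected_tree_arcs)
    show "finite (pverts G)" "parcs G \<subseteq> pverts G \<times> pverts G" "sym (parcs G)" by (rule S)+
    show "pverts G \<noteq> {}" using sc by (auto simp: strongly_connected_def)
    show "irrefl (parcs G)" using S(5) by (auto simp: irrefl_def)
    show "(a, b) \<in> (parcs G)\<^sup>*" if "a \<in> pverts G" "b \<in> pverts G" for a b
    proof -
      have "(a, b) \<in> rtrancl_on (pverts G) (parcs G)"
        using sc that by (simp add: strongly_connected_def reachable_def)
      then show ?thesis by (rule rtrancl_on_rtranclI)
    qed
    fix xs assume xs: "distinct xs" "3 \<le> length xs" "successively (\<lambda>a b. (a, b) \<in> parcs G) xs"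
    show "(last xs, hd xs) \<notin> parcs G"
    proof
      assume l: "(last xs, hd xs) \<in> parcs G"
      obtain x ys where xys: "xs = x # ys" using xs(2) by (cases xs) auto
      let ?p = "zip (x # ys) (ys @ [x])"
      have "(a, b) \<in> parcs G" if "(a, b) \<in> set ?p" for a b
        using set_zip_successively[of "\<lambda>a b. (a, b) \<in> parcs G" x ys x a b] xs(3) l that by (simp add: xys)
      then have "set ?p \<subseteq> parcs G" by auto
      moreover have "x \<in> pverts G" using l S(3) by (auto simp: xys)
      ultimately have "awalk x ?p x" by (simp only: awalk_def pcas_zip simp_thms)
      moreover have "distinct (tl (pawalk_verts x ?p))"
        using xs(1) unfolding pawalk_verts_zip xys by simp
      ultimately have "cycle ?p" unfolding cycle_def by (intro exI[of _ x] conjI) (cases ys, auto)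
      then show False using acyc[of ?p] xs(2) by (simp add: xys)
    qed
  qed
qed

lemma tree_arcs_card: "tree_arcs V E \<Longrightarrow> finite V \<and> finite E \<and> E \<subseteq> V \<times> V \<and> card E + 2 = 2 * card V"
proof (induction rule: tree_arcs.induct)
  case (leaf V E y x)
  then have "card (E \<union> {(x, y), (y, x)}) = card E + card {(x, y), (y, x)}"
    by (intro card_Un_disjoint) auto
  moreover have "x \<noteq> y" using leaf.hyps by blast
  then have "card {(x, y), (y, x)} = 2" by simp
  ultimately show ?case using leaf by auto
qed simp

lemma tree_size:
  assumes "undirected_tree G"
  shows "graph_size G + 1 = graph_order G"
  using tree_arcs_card[OF undirected_tree_tree_arcs[OF assms]] card_arcs_eq[of G] assms
  by (auto simp: undirected_tree_def graph_order_def)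

section \<open>Trees of diameter at most three\<close>

definition near :: "('a \<times> 'a) set \<Rightarrow> 'a \<Rightarrow> 'a \<Rightarrow> bool" where
  "near E a b \<longleftrightarrow> a = b \<or> (a, b) \<in> E \<or> (\<exists>p. (a, p) \<in> E \<and> (p, b) \<in> E) \<or>
     (\<exists>p q. (a, p) \<in> E \<and> (p, q) \<in> E \<and> (q, b) \<in> E)"

text \<open>With unit weights the cost of a walk is its length. The distance is an infimum below 4,
  so some walk has at most three arcs, and \<open>near\<close> spells out the possible
  shapes.\<close>

lemma diameter_near:
  assumes pg: "pair_graph G" and diam: "graph_diameter G \<le> 3"
    and ab: "a \<in> pverts G" "b \<in> pverts G"
  shows "near (parcs G) a b"
proof -
  interpret pair_graph G by (rule pg)
  have "graph_distance G a b \<le> (SUP v\<in>pverts G. graph_distance G a v)"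
    by (rule SUP_upper) (rule ab)
  also have "\<dots> \<le> graph_diameter G"
    unfolding graph_diameter_def by (rule SUP_upper) (rule ab)
  also have "\<dots> < 4" using diam by (rule le_less_trans) simp
  finally obtain p where p: "awalk a p b" "ereal (awalk_cost (\<lambda>_. 1) p) < 4"
    unfolding graph_distance_def \<mu>_def by (auto simp: INF_less_iff)
  have "awalk_cost (\<lambda>_. 1) p = real (length p)" by (induction p) (auto simp: awalk_cost_def)
  then have "length p < 4" using p(2) by simp
  moreover have "set p \<subseteq> parcs G" "pcas a p b" using p(1) by (auto simp: awalk_def)
  ultimately show ?thesis
    by (cases p; cases "tl p"; cases "tl (tl p)"; cases "tl (tl (tl p))")
      (auto simp: near_def)
qed

text \<open>\<open>A\<close> and \<open>B\<close> are the leaves at the centres \<open>c\<close> and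
  \<open>d\<close>. Either may be empty, which covers stars.\<close>

definition double_star :: "'a \<Rightarrow> 'a \<Rightarrow> 'a set \<Rightarrow> 'a set \<Rightarrow> ('a \<times> 'a) set" where
  "double_star c d A B = {(c, d), (d, c)} \<union> {c} \<times> A \<union> A \<times> {c} \<union> {d} \<times> B \<union> B \<times> {d}"

text \<open>A walk between other vertices can visit \<open>x\<close> only as a detour from
  \<open>y\<close> back to \<open>y\<close>, and the detour can be cut out.\<close>

lemma near_remove_leaf:
  assumes "near (E \<union> {(x, y), (y, x)}) a b" "a \<noteq> x" "b \<noteq> x" "E \<subseteq> V \<times> V" "x \<notin> V"
  shows "near E a b"
  using assms unfolding near_def by auto

text \<open>A potential that changes by at most one along every arc certifies a distance of at least
  four.\<close>

lemma lipschitz_not_near: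
  fixes h :: "'a \<Rightarrow> int"
  assumes "\<And>p q. (p, q) \<in> E \<Longrightarrow> \<bar>h p - h q\<bar> \<le> 1" "\<bar>h a - h b\<bar> \<ge> 4"
  shows "\<not> near E a b"
  using assms(2) unfolding near_def by (auto dest!: assms(1))

lemma tree_diameter_three:
  assumes "tree_arcs V E" "2 \<le> card V" "\<And>a b. a \<in> V \<Longrightarrow> b \<in> V \<Longrightarrow> near E a b"
  shows "\<exists>c d A B. c \<noteq> d \<and> {c, d} \<inter> (A \<union> B) = {} \<and> A \<inter> B = {} \<and> V = {c, d} \<union> A \<union> B \<and> E = double_star c d A B"
  using assms
proof (induction rule: tree_arcs.induct)
  case (leaf V E y x)
  note fin = tree_arcs_card[OF leaf.hyps(1)]
  show ?case
  proof (cases "card V \<ge> 2")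
    case False
    then have "card V = 1" using leaf.hyps(2) fin
card_gt_0_iff[of V] by (cases "V = {}") auto
    then have V: "V = {y}" using leaf.hyps(2) by (auto simp: card_1_singleton_iff)
    then have "E = {}" using fin by auto
    then show ?thesis using V leaf.hyps(3)
      by (intro exI[of _ x] exI[of _ y] exI[of _ "{}"]) (auto simp: double_star_def)
  next
    case True
    have "near E a b" if "a \<in> V" "b \<in> V" for a b
      using near_remove_leaf[OF leaf.prems(2)[of a b], of V] that fin leaf.hyps(3) by auto
    then obtain c d A B where cd: "c \<noteq> d" "{c, d} \<inter> (A \<union> B) = {}" "A \<inter> B = {}"
      "V = {c, d} \<union> A \<union> B" "E = double_star c d A B"
      using leaf.IH[OF True] by blast
    have key: "\<exists>c d A B. c \<noteq> d \<and> {c, d} \<inter> (A \<union> B) = {} \<and> A \<inter> B = {} \<and>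
        insert x V = {c, d} \<union> A \<union> B \<and> E \<union> {(x, y), (y, x)} = double_star c d A B"
      if cd: "c \<noteq> d" "{c, d} \<inter> (A \<union> B) = {}" "A \<inter> B = {}"
        "V = {c, d} \<union> A \<union> B" "E = double_star c d A B" and y: "y = c \<or> y \<in> A" for c d A B
    proof (cases "y = c")
      case True
      show ?thesis
      proof (intro exI conjI)
        show "E \<union> {(x, y), (y, x)} = double_star c d (insert x A) B"
          unfolding cd(5) True double_star_def by blast
        show "insert x V = {c, d} \<union> insert x A \<union> B" unfolding cd(4) by blast
      qed (use cd(1-4) leaf.hyps(3) in blast)+
    next
      case False
      then have y: "y \<in> A" using y by simp
      have "B = {}"
      proof (rule ccontr)
        assume "B \<noteq> {}"
        then obtain b where b: "b \<in> B" by blast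
        \<comment> \<open>\<open>h\<close> rises from 0 to 4 along the path x, y, c, d, b. The other
          leaves at \<open>c\<close> may share the value 1 of \<open>y\<close>, since they touch
          only \<open>c\<close>.\<close>
        define h :: "'a \<Rightarrow> int" where
          "h z = (if z = x then 0 else if z = c then 2 else if z = d then 3 else if z \<in> B then 4 else 1)" for z
        have "\<not> near (E \<union> {(x, y), (y, x)}) x b"
          by (rule lipschitz_not_near[of _ h])
            (use cd leaf.hyps(3) y b in \<open>auto simp: h_def double_star_def\<close>)
        then show False using leaf.prems(2)[of x b] b cd by auto
      qed
      \<comment> \<open>The old tree is a star at \<open>c\<close>: \<open>d\<close> becomes one of
        its leaves, and \<open>y\<close> becomes the second centre, with the single leaf
        \<open>x\<close>.\<close>
      show ?thesis
      proof (intro exI conjI)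
        show "E \<union> {(x, y), (y, x)} = double_star c y (insert d (A - {y})) {x}"
          unfolding cd(5) \<open>B = {}\<close> double_star_def using y by blast
        show "insert x V = {c, y} \<union> insert d (A - {y}) \<union> {x}"
          unfolding cd(4) \<open>B = {}\<close> using y by blast
      qed (use cd(1-4) leaf.hyps(3) y \<open>B = {}\<close> in blast)+
    qed
    from leaf.hyps(2) cd(4) consider "y = c \<or> y \<in> A" | "y = d \<or> y \<in> B" by blast
    then show ?thesis
    proof cases
      case 1
      then show ?thesis by (rule key[OF cd])
    next
      case 2
      have sw: "d \<noteq> c" "{d, c} \<inter> (B \<union> A) = {}" "B \<inter> A = {}"
        "V = {d, c} \<union> B \<union> A" "E = double_star d c B A"
        using cd(1-3) unfolding cd(4,5) double_star_def by blast+
      show ?thesis by (rule key[OF sw 2])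
    qed
  qed
qed simp

section \<open>Test vectors for the upper eigenvalues of a double star\<close>

lemma (in laplacian_eigenbasis) orthogonal_family_le:
  assumes "finite I"
    and pos: "\<And>i. i \<in> I \<Longrightarrow> inner_on (pverts G) (f i) (f i) > 0"
    and orth: "\<And>i j. i \<in> I \<Longrightarrow> j \<in> I \<Longrightarrow> i \<noteq> j \<Longrightarrow> inner_on (pverts G) (f i) (f j) = 0"
  shows "(\<Sum>i\<in>I. dirichlet (parcs G) (f i) (f i) / inner_on (pverts G) (f i) (f i) - t)
    \<le> (\<Sum>j | j < graph_order G \<and> ev j \<ge> t. ev j - t)"
proof -
  let ?n = "\<lambda>i. inner_on (pverts G) (f i) (f i)"
  \<comment> \<open>Normalizing here, once and for all, permits test vectors with integer
    entries.\<close>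
  define F where "F i x = f i x / sqrt (?n i)" for i x
  have F: "inner_on (pverts G) (F i) (F j) = inner_on (pverts G) (f i) (f j) / (sqrt (?n i) * sqrt (?n j))" for i j
    by (simp add: inner_on_def F_def sum_divide_distrib)
  have "orthonormal_on (pverts G) I F"
    unfolding orthonormal_on_def
  proof (intro ballI)
    fix i j assume "i \<in> I" "j \<in> I"
    then show "inner_on (pverts G) (F i) (F j) = (if i = j then 1 else 0)"
      using pos[of i] orth[of i j] by (auto simp: F)
  qed
  note le = orthonormal_family_le[OF this assms(1), of t]
  have "dirichlet (parcs G) (F i) (F i) = dirichlet (parcs G) (f i) (f i) / ?n i" if "i \<in> I" for i
  proof -
    have "(F i x - F i y)\<^sup>2 = (f i x - f i y)\<^sup>2 / ?n i" for x y
      using pos[OF that] by (simp add: F_def diff_divide_distrib[symmetric] power_divide)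
    then show ?thesis by (simp add: dirichlet_self sum_divide_distrib case_prod_beta mult.commute[of 2])
  qed
  then have "(\<Sum>i\<in>I. dirichlet (parcs G) (f i) (f i) / ?n i - t)
      = (\<Sum>i\<in>I. dirichlet (parcs G) (F i) (F i) - t)"
    by (intro sum.cong) auto
  also note le
  also have "(\<Sum>j<graph_order G. max 0 (ev j - t)) = (\<Sum>j\<in>{j\<in>{..<graph_order G}. ev j \<ge> t}. ev j - t)"
    by (subst sum.inter_filter) (auto intro!: sum.cong simp: max_def)
  also have "{j\<in>{..<graph_order G}. ev j \<ge> t} = {j. j < graph_order G \<and> ev j \<ge> t}" by auto
  finally show ?thesis .
qed

text \<open>\<open>p\<close> and \<open>r\<close> are the values at the centres, \<open>q\<close>
  and \<open>s\<close> those on their leaves. Eigenvectors that sum to zero on one leaf set and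
  vanish elsewhere have eigenvalue 1, below the threshold, so functions constant on the leaf sets
  lose nothing.\<close>

definition two_level :: "'a \<Rightarrow> 'a \<Rightarrow> 'a set \<Rightarrow> 'a set \<Rightarrow> real \<Rightarrow> real \<Rightarrow> real \<Rightarrow> real \<Rightarrow> 'a \<Rightarrow> real" where
  "two_level c d A B p q r s x =
     (if x = c then p else if x = d then r else if x \<in> A then q else if x \<in> B then s else 0)"

context
  fixes c d :: 'a and A B V :: "'a set"
  assumes cd: "c \<noteq> d" "{c, d} \<inter> (A \<union> B) = {}" "A \<inter> B = {}" "V = {c, d} \<union> A \<union> B"
    and fin: "finite V"
begin

lemma finite_AB: "finite A" "finite B"
  using cd fin by auto

lemma two_level_eval:
  "two_level c d A B p q r s c = p" "two_level c d A B p q r s d = r"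
  "x \<in> A \<Longrightarrow> two_level c d A B p q r s x = q" "x \<in> B \<Longrightarrow> two_level c d A B p q r s x = s"
  using cd by (auto simp: two_level_def)

lemma inner_on_two_level:
  fixes p q r s p' q' r' s' :: real
  shows "inner_on V (two_level c d A B p q r s) (two_level c d A B p' q' r' s')
    = p * p' + r * r' + card A * (q * q') + card B * (s * s')"
proof -
  have V: "V = {c, d} \<union> (A \<union> B)" using cd(4) by blast
  have "inner_on V f f' = (\<Sum>x\<in>{c, d}. f x * f' x) + ((\<Sum>x\<in>A. f x * f' x) + (\<Sum>x\<in>B. f x * f' x))" for f f' :: "'a \<Rightarrow> real"
    unfolding inner_on_def V using cd(2,3) finite_AB
    by (subst sum.union_disjoint, simp, simp, blast, subst sum.union_disjoint) auto
  then show ?thesis using cd(1) by (simp add: two_level_eval)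
qed

lemma dirichlet_two_level:
  fixes p q r s :: real
  shows "dirichlet (double_star c d A B) (two_level c d A B p q r s) (two_level c d A B p q r s)
    = (p - r)\<^sup>2 + card A * (p - q)\<^sup>2 + card B * (r - s)\<^sup>2"
proof -
  define f where "f = two_level c d A B p q r s"
  let ?w = "\<lambda>(x, y). (f x - f y)\<^sup>2"
  have E: "double_star c d A B
      = {(c, d), (d, c)} \<union> (({c} \<times> A \<union> A \<times> {c}) \<union> ({d} \<times> B \<union> B \<times> {d}))"
    by (auto simp: double_star_def)
  have "sum ?w (double_star c d A B) = sum ?w {(c, d), (d, c)}
      + ((sum ?w ({c} \<times> A) + sum ?w (A \<times> {c})) + (sum ?w ({d} \<times> B) + sum ?w (B \<times> {d})))"
    unfolding E using cd(1-3) finite_AB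
    by (subst sum.union_disjoint, simp, simp, blast)
      (subst sum.union_disjoint, simp, simp, blast,
       subst sum.union_disjoint, simp, simp, blast, subst sum.union_disjoint, simp, simp, blast, simp)
  moreover have "sum ?w {(c, d), (d, c)} = 2 * (p - r)\<^sup>2"
    using cd(1) by (simp add: f_def two_level_eval power2_commute[of r])
  moreover have "sum ?w ({c} \<times> A) = card A * (p - q)\<^sup>2" "sum ?w (A \<times> {c}) = card A * (p - q)\<^sup>2"
    by (simp_all add: sum.cartesian_product[symmetric] f_def two_level_eval power2_commute[of q])
  moreover have "sum ?w ({d} \<times> B) = card B * (r - s)\<^sup>2" "sum ?w (B \<times> {d}) = card B * (r - s)\<^sup>2"
    by (simp_all add: sum.cartesian_product[symmetric] f_def two_level_eval power2_commute[of s])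
  ultimately show ?thesis unfolding dirichlet_self f_def by simp
qed

end


text \<open>The fraction is the amount by which the Rayleigh quotient of the vector with
  \<open>a + 1\<close> at a centre and -1 on its \<open>a\<close> leaves falls short of
  \<open>a + 2\<close>. Monotonicity leaves only a few small sizes to evaluate.\<close>

lemma star_defect_antimono:
  fixes a :: nat
  assumes "a \<ge> k" "k \<ge> 1"
  shows "(real a + 1) / ((real a + 1)\<^sup>2 + real a) \<le> (real k + 1) / ((real k + 1)\<^sup>2 + real k)"
proof -
  have "(real a + 1) * ((real k + 1)\<^sup>2 + real k) \<le> (real k + 1) * ((real a + 1)\<^sup>2 + real a)"
  proof -
    have "0 \<le> (real a - real k) * (real a * real k + real a + real k + 2)"
      using assms by (intro mult_nonneg_nonneg) auto
    then show ?thesis by (simp add: power2_eq_square algebra_simps)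
  qed
  moreover have "(real a + 1)\<^sup>2 + real a > 0" "(real k + 1)\<^sup>2 + real k > 0"
    by (simp_all add: add_pos_nonneg)
  ultimately show ?thesis by (simp add: divide_le_eq le_divide_eq field_simps)
qed

context laplacian_eigenbasis
begin

lemma single_vector_le:
  assumes "inner_on (pverts G) f f > 0"
  shows "dirichlet (parcs G) f f / inner_on (pverts G) f f - t
    \<le> (\<Sum>j | j < graph_order G \<and> ev j \<ge> t. ev j - t)"
  using orthogonal_family_le[of "{0::nat}" "\<lambda>_. f" t] assms by simp

lemma two_vectors_le:
  assumes "inner_on (pverts G) f f > 0" "inner_on (pverts G) h h > 0" "inner_on (pverts G) f h = 0"
  shows "dirichlet (parcs G) f f / inner_on (pverts G) f f + dirichlet (parcs G) h h / inner_on (pverts G) h h - 2 * t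
    \<le> (\<Sum>j | j < graph_order G \<and> ev j \<ge> t. ev j - t)"
proof -
  have "inner_on (pverts G) h f = 0" using assms(3) by (simp add: inner_on_commute[of _ h f])
  then have "(\<Sum>i\<in>{0, 1::nat}. dirichlet (parcs G) ((if i = 0 then f else h)) ((if i = 0 then f else h)) /
      inner_on (pverts G) ((if i = 0 then f else h)) ((if i = 0 then f else h)) - t)
    \<le> (\<Sum>j | j < graph_order G \<and> ev j \<ge> t. ev j - t)"
    by (intro orthogonal_family_le) (use assms in auto)
  then show ?thesis by simp
qed

end

section \<open>The Laplacian energy of a path\<close>

lemma sin_ge_cubic:
  fixes x :: real
  assumes "x \<ge> 0"
  shows "sin x \<ge> x - x ^ 3 / 6"
proof -
  have "\<bar>sin x - (\<Sum>m<3. sin_coeff m * x ^ m)\<bar> \<le> inverse (fact 3) * \<bar>x\<bar> ^ 3"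
    by (rule Maclaurin_sin_bound)
  moreover have "(\<Sum>m<3. sin_coeff m * x ^ m) = x"
    by (simp add: eval_nat_numeral sin_coeff_def)
  moreover have "inverse (fact 3) * \<bar>x\<bar> ^ 3 = x ^ 3 / 6" using assms by (simp add: fact_numeral)
  ultimately show ?thesis by linarith
qed

lemma sin_le_quintic:
  fixes x :: real
  assumes "x \<ge> 0"
  shows "sin x \<le> x - x ^ 3 / 6 + x ^ 5 / 120"
proof -
  have "\<bar>sin x - (\<Sum>m<5. sin_coeff m * x ^ m)\<bar> \<le> inverse (fact 5) * \<bar>x\<bar> ^ 5"
    by (rule Maclaurin_sin_bound)
  moreover have "{..<5::nat} = {0, 1, 2, 3, 4}" by auto
  then have "(\<Sum>m<5. sin_coeff m * x ^ m) = x - x ^ 3 / 6"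
    by (simp add: sin_coeff_def fact_numeral)
  moreover have "inverse (fact 5) * \<bar>x\<bar> ^ 5 = x ^ 5 / 120" using assms by (simp add: fact_numeral)
  ultimately show ?thesis by linarith
qed

text \<open>Both bounds compare sine at a rational point with its value 1/2 at
  \<open>pi / 6\<close>.\<close>

lemma pi_bounds: "314/100 \<le> pi" "pi \<le> 315/100"
proof -
  show "314/100 \<le> pi"
  proof (rule ccontr)
    assume "\<not> ?thesis"
    then have "sin (pi / 6) \<le> sin (314/600)"
      using pi_ge_two by (intro sin_monotone_2pi_le) auto
    also have "\<dots> \<le> 314/600 - (314/600) ^ 3 / 6 + (314/600) ^ 5 / 120" by (rule sin_le_quintic) simp
    also have "\<dots> < 1/2" by (simp add: eval_nat_numeral)
    finally show False by (simp add: sin_30)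
  qed
  show "pi \<le> 315/100"
  proof (rule ccontr)
    assume "\<not> ?thesis"
    then have "sin (315/600) \<le> sin (pi / 6)"
      using pi_less_4 by (intro sin_monotone_2pi_le) auto
    moreover have "sin (315/600) \<ge> 315/600 - (315/600) ^ 3 / (6::real)" by (rule sin_ge_cubic) simp
    moreover have "315/600 - (315/600) ^ 3 / 6 > (1/2 :: real)" by (simp add: eval_nat_numeral)
    ultimately show False by (simp add: sin_30)
  qed
qed

text \<open>The Dirichlet kernel, telescoped by the product formula.\<close>

lemma sum_cos_multiples:
  "2 * sin (t / 2) * (\<Sum>j<m. cos (real j * t)) = sin (t / 2) + sin ((real m - 1/2) * t)"
proof (induction m)
  case 0
  show ?case using sin_minus[of "t / 2"] by simp
next
  case (Suc m)
  have "2 * sin (t / 2) * cos (real m * t) = sin (real m * t + t / 2) - sin (real m * t - t / 2)"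
    by (simp add: sin_add sin_diff)
  moreover have "real m * t - t / 2 = (real m - 1/2) * t" "real m * t + t / 2 = (real (Suc m) - 1/2) * t"
    by (simp_all add: algebra_simps)
  ultimately show ?case using Suc by (simp add: distrib_left)
qed

text \<open>The positive terms form an initial segment. Its length may remain unknown, because the
  kernel estimate is uniform in it.\<close>

lemma sum_max_antimono:
  fixes a :: "nat \<Rightarrow> real"
  assumes "\<And>i j. i \<le> j \<Longrightarrow> j < n \<Longrightarrow> a j \<le> a i"
  shows "\<exists>m\<le>n. (\<Sum>j<n. max 0 (a j)) = (\<Sum>j<m. a j)"
  using assms
proof (induction n)
  case (Suc n)
  show ?case
  proof (cases "a n \<ge> 0")
    case True
    then have "max 0 (a j) = a j" if "j < Suc n" for j using Suc.prems[of j n] that by simp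
    then show ?thesis by (intro exI[of _ "Suc n"]) simp
  next
    case False
    have "\<exists>m\<le>n. (\<Sum>j<n. max 0 (a j)) = (\<Sum>j<m. a j)"
      by (rule Suc.IH) (rule Suc.prems, simp_all)
    then obtain m where "m \<le> n" "(\<Sum>j<n. max 0 (a j)) = (\<Sum>j<m. a j)" by blast
    then show ?thesis using False by (intro exI[of _ m]) simp
  qed
qed simp

section \<open>Spectrum and energy of the path\<close>

lemma pair_graph_path: "pair_graph (path_graph n)"
proof -
  have "parcs (path_graph n) \<subseteq> {..<n} \<times> {..<n}" by (auto simp: path_graph_def)
  then have "finite (parcs (path_graph n))" using finite_subset by blast
  then show ?thesis
    by unfold_locales (auto simp: path_graph_def arcs_ends_conv symmetric_def intro!: symI)
qed

lemma graph_size_path: "graph_size (path_graph n) = n - 1"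
proof -
  have "{{u, v} |u v. (u, v) \<in> parcs (path_graph n)} = (\<lambda>i. {i, Suc i}) ` {..<n - 1}"
  proof (intro equalityI subsetI)
    fix e assume "e \<in> (\<lambda>i. {i, Suc i}) ` {..<n - 1}"
    then obtain i where i: "e = {i, Suc i}" "Suc i < n" by auto
    then have "(i, Suc i) \<in> parcs (path_graph n)" by (simp add: path_graph_def)
    then show "e \<in> {{u, v} |u v. (u, v) \<in> parcs (path_graph n)}" using i(1) by blast
  qed (auto simp: path_graph_def)
  moreover have "inj_on (\<lambda>i. {i, Suc i}) {..<n - 1}"
    by (auto simp: inj_on_def doubleton_eq_iff)
  ultimately show ?thesis by (simp add: graph_size_def card_image)
qed

text \<open>
  Reflecting at the half-integers before the first and after the last vertex turns the two
  missing neighbours at the ends into vanishing differences.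
\<close>

lemma laplacian_path_cos:
  assumes "i < n" "j < n"
  defines "t \<equiv> pi * real j / real n"
  shows "laplacian (parcs (path_graph n)) (\<lambda>k. cos ((real k + 1/2) * t)) i
    = (2 - 2 * cos t) * cos ((real i + 1/2) * t)"
proof -
  let ?f = "\<lambda>k::nat. cos ((real k + 1/2) * t)"
  have "{y. (i, y) \<in> parcs (path_graph n)} = (if 0 < i then {i - 1} else {}) \<union> (if Suc i < n then {Suc i} else {})"
    using assms(1) by (auto simp: path_graph_def)
  then have "laplacian (parcs (path_graph n)) ?f i
      = (if 0 < i then ?f i - ?f (i - 1) else 0) + (if Suc i < n then ?f i - ?f (Suc i) else 0)"
    by (auto simp: laplacian_def)
  moreover have "(if 0 < i then ?f i - ?f (i - 1) else 0) = ?f i - cos ((real i - 1/2) * t)"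
  proof (cases "i = 0")
    case True
    then show ?thesis using cos_minus[of "t / 2"] by simp
  qed (simp add: of_nat_diff algebra_simps)
  moreover have "(if Suc i < n then ?f i - ?f (Suc i) else 0) = ?f i - cos ((real i + 3/2) * t)"
  proof (cases "Suc i < n")
    case False
    then have n: "real n = real i + 1" using assms(1) by simp
    have "t * real n = pi * real j" using assms(1) by (simp add: t_def)
    then have "(real i + 1/2) * t = pi * real j - t / 2" "(real i + 3/2) * t = pi * real j + t / 2"
      unfolding n by (simp_all add: algebra_simps)
    then show ?thesis using False sin_npi2[of j] by (simp add: cos_add cos_diff)
  qed (simp add: algebra_simps)
  moreover have "cos ((real i - 1/2) * t) + cos ((real i + 3/2) * t) = 2 * cos t * ?f i"
  proof -
    have "(real i - 1/2) * t = (real i + 1/2) * t - t" "(real i + 3/2) * t = (real i + 1/2) * t + t"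
      by (simp_all add: algebra_simps)
    then show ?thesis by (simp add: cos_add cos_diff)
  qed
  ultimately show ?thesis by (simp add: algebra_simps)
qed

text \<open>The n numbers 2 - 2 cos (pi j / n) are distinct eigenvalues, so they exhaust the
  spectrum by counting, and the cosine vectors need not be shown orthogonal.\<close>

lemma laplacian_energy_path_le:
  assumes n: "n \<ge> 2"
  shows "laplacian_energy (path_graph n) \<le> 2 + 4 * real n / pi"
proof -
  let ?G = "path_graph n" and ?t = "\<lambda>j. pi * real j / real n"
  have V: "pverts ?G = {..<n}" "graph_order ?G = n" by (simp_all add: path_graph_def graph_order_def)
  obtain g ev where "laplacian_eigenbasis ?G g ev"
    using laplacian_eigenbasis_exists[OF pair_graph_path] by blast
  then interpret laplacian_eigenbasis ?G g ev .
  let ?mu = "\<lambda>j::nat. 2 - 2 * cos (?t j)"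
  have ev_mem: "?mu j \<in> ev ` {..<n}" if j: "j < n" for j
  proof -
    let ?f = "\<lambda>k::nat. cos ((real k + 1/2) * ?t j)"
    \<comment> \<open>The cosine vector is nonzero at vertex 0, so it overlaps some
      \<open>g i\<close>; moving the Laplacian across this inner product identifies
      \<open>ev i\<close>.\<close>
    have "?f 0 > 0"
    proof (rule cos_gt_zero_pi)
      have "?t j / 2 < pi / 2" using j by (simp add: field_simps)
      then show "(real 0 + 1/2) * ?t j < pi / 2" by simp
      show "- (pi / 2) < (real 0 + 1/2) * ?t j" by (rule less_le_trans[of _ 0]) simp_all
    qed
    then obtain i where i: "i < n" "inner_on {..<n} (g i) ?f \<noteq> 0"
      using expansion[of 0 ?f] n V by (metis (no_types, lifting) mult_zero_left less_irrefl
        sum.neutral lessThan_iff less_le_trans zero_less_numeral)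
    have "ev i * inner_on {..<n} (g i) ?f = dirichlet (parcs ?G) ?f (g i)"
      using dirichlet_eigen[of i ?f] i V by simp
    also have "\<dots> = inner_on {..<n} (g i) (laplacian (parcs ?G) ?f)"
      using inner_on_laplacian[OF simps(1,3,4), of "g i" ?f] V by (simp add: dirichlet_commute)
    also have "\<dots> = inner_on {..<n} (g i) (\<lambda>k. ?mu j * ?f k)"
      by (rule inner_on_cong) (use laplacian_path_cos[OF _ j] in auto)
    also have "\<dots> = ?mu j * inner_on {..<n} (g i) ?f" by (rule inner_on_scale_right)
    finally have "?mu j = ev i" using i(2) by simp
    then show ?thesis using i(1) by (intro image_eqI[of _ _ i]) simp_all
  qed
  have inj: "inj_on ?mu {..<n}"
  proof (rule inj_onI)
    fix i j assume ij: "i \<in> {..<n}" "j \<in> {..<n}" and eq: "?mu i = ?mu j"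
    have "?t k \<le> pi" if "k < n" for k using that by (simp add: field_simps)
    then have "?t i = ?t j" using cos_inj_pi[of "?t i" "?t j"] ij eq by simp
    then show "i = j" using n by simp
  qed
  have "?mu ` {..<n} = ev ` {..<n}"
  proof (rule card_seteq)
    show "?mu ` {..<n} \<subseteq> ev ` {..<n}" using ev_mem by blast
    show "card (ev ` {..<n}) \<le> card (?mu ` {..<n})"
      unfolding card_image[OF inj] by (rule card_image_le) simp
  qed simp
  moreover from this have "inj_on ev {..<n}"
    using card_image[OF inj] by (intro eq_card_imp_inj_on) auto
  ultimately have sum_eq: "(\<Sum>i<n. F (ev i)) = (\<Sum>j<n. F (?mu j))" for F :: "real \<Rightarrow> real"
    using sum.reindex[of ev "{..<n}" F] sum.reindex[OF inj, of F] by (simp add: o_def)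
  define x where "x = pi / (2 * real n)"
  have x: "0 < x" "x \<le> 1" using n pi_less_4 by (auto simp: x_def field_simps)
  define a where "a j = 2 * cos (?t j) - 2 / real n" for j
  have d: "avg_degree ?G = 2 - 2 / real n"
    using n by (simp add: avg_degree_def V graph_size_path of_nat_diff field_simps)
  \<comment> \<open>The parts below the average are summed: the selected \<open>j\<close> then start
    at 0, as the kernel formula requires.\<close>
  have "laplacian_energy ?G = 2 * (\<Sum>i<n. max 0 (ev i - avg_degree ?G)) - 2 * (\<Sum>i<n. ev i - avg_degree ?G)"
    using laplacian_energy_max sum_ev_minus_avg V by simp
  also have "\<dots> = 2 * (\<Sum>i<n. max 0 (avg_degree ?G - ev i))"
    unfolding right_diff_distrib[symmetric] sum_subtractf[symmetric]
    by (intro arg_cong[where f="(*) 2"] sum.cong) auto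
  also have "\<dots> = 2 * (\<Sum>j<n. max 0 (a j))"
    unfolding sum_eq[of "\<lambda>e. max 0 (avg_degree ?G - e)"] by (simp add: d a_def algebra_simps)
  finally have LE: "laplacian_energy ?G = 2 * (\<Sum>j<n. max 0 (a j))" .
  have "a j \<le> a i" if "i \<le> j" "j < n" for i j
    using that n by (auto simp: a_def field_simps intro!: cos_monotone_0_pi_le)
  then obtain m where m: "m \<le> n" "(\<Sum>j<n. max 0 (a j)) = (\<Sum>j<m. a j)"
    using sum_max_antimono[of n a] by blast
  show ?thesis
  proof (cases "m = 0")
    case True
    then show ?thesis using LE m by simp
  next
    case False
    have sx: "sin x \<ge> x - x ^ 3 / 6" using x by (intro sin_ge_cubic) simp
    have x3: "x ^ 3 \<le> x" using x power_decreasing[of 1 3 x] by simp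
    have sp: "sin x > 0" using sx x x3 by simp
    have "2 * sin x * (\<Sum>j<m. cos (real j * (pi / n))) \<le> sin x + 1"
      using sum_cos_multiples[of "pi / n" m] sin_le_one[of "(real m - 1/2) * (pi / n)"]
      by (simp add: x_def mult.commute)
    then have "2 * (\<Sum>j<m. cos (?t j)) \<le> 1 + 1 / sin x"
      using sp by (simp add: field_simps)
    then have "(\<Sum>j<m. a j) \<le> 1 + 1 / sin x - 2 * real m / n"
      by (simp add: a_def sum_subtractf sum_distrib_left mult.commute[of "real m" 2])
    \<comment> \<open>As \<open>m \<ge> 1\<close>, the subtracted term is at least
      \<open>2 / n\<close>, which pays for replacing \<open>1 / sin x\<close> by
      \<open>1 / x\<close>.\<close>
    moreover have "2 * real m / n \<ge> 4 * x / pi" using False n by (simp add: x_def field_simps)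
    moreover have "1 / sin x \<le> 1 / x + 4 * x / pi"
    proof -
      have "1 \<le> (1 / x + x) * (x - x ^ 3 / 6)"
      proof -
        have "(1 / x + x) * (x - x ^ 3 / 6) = 1 + x\<^sup>2 * (5/6 - x\<^sup>2 / 6)"
          using x by (simp add: field_simps eval_nat_numeral)
        moreover have "x\<^sup>2 \<le> 1" using x by (simp add: power_le_one)
        ultimately show ?thesis by simp
      qed
      also have "\<dots> \<le> (1 / x + 4 * x / pi) * sin x"
        using sx x x3 pi_less_4 by (intro mult_mono add_mono) (auto simp: field_simps)
      finally show ?thesis using sp by (simp add: field_simps)
    qed
    ultimately have "(\<Sum>j<m. a j) \<le> 1 + 1 / x" by argo
    then show ?thesis using LE m by (simp add: x_def)
  qed
qed

section \<open>The energy of the joined tree\<close>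

lemma two_div_pi: "2 / pi \<le> 100/157"
  using pi_bounds(1) by (simp add: field_simps)

section \<open>Numerical inequalities behind the budget\<close>

context
  fixes n1 n2 n s :: nat and L :: real
  assumes n: "n = n1 + n2" "n1 \<ge> n2" "n2 \<ge> 6"
    and L: "L \<ge> 2 + 4 * real n1 / pi" "L \<le> 2 * (real n1 - real s) * (2 - 2 / real n1)"
begin

text \<open>Both bounds on \<open>L\<close>, with 1/pi replaced by 20/63 and denominators cleared.
  This sharp form lets the integrality of \<open>s\<close> be exploited for small
  \<open>n1\<close>.\<close>

lemma count_bound_exact: "2 * (real n1 - real s) * (real n1 - 1) \<ge> real n1 + 40/63 * (real n1)\<^sup>2"
proof -
  have n1: "real n1 \<ge> 6" using n by simp
  have "1 / pi \<ge> 100/315" using pi_bounds(2) by (simp add: field_simps)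
  then have "4 * real n1 * (100/315) \<le> 4 * real n1 * (1 / pi)" by (intro mult_left_mono) auto
  then have "2 + 4 * real n1 * (100/315) \<le> 2 * (real n1 - real s) * (2 - 2 / real n1)" using L by simp
  then have "real n1 * (2 + 4 * real n1 * (100/315)) \<le> real n1 * (2 * (real n1 - real s) * (2 - 2 / real n1))"
    by (intro mult_left_mono) auto
  also have "\<dots> = 4 * (real n1 - real s) * (real n1 - 1)" using n1 by (simp add: field_simps)
  finally show ?thesis by (simp add: power2_eq_square algebra_simps)
qed

text \<open>Division by \<open>2 * (n1 - 1)\<close>, dropping the remainder 103/63.\<close>

lemma count_bound: "real s \<le> 43/63 * real n1 - 103/126"
proof -
  have n1: "real n1 \<ge> 6" using n by simp
  have "(1/2 + 20/63 * (real n1 + 1)) * (2 * (real n1 - 1)) = real n1 + 40/63 * (real n1)\<^sup>2 - 103/63"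
    by (simp add: power2_eq_square field_simps)
  also have "\<dots> \<le> 2 * (real n1 - real s) * (real n1 - 1)" using count_bound_exact by argo
  also have "\<dots> = (real n1 - real s) * (2 * (real n1 - 1))" by (simp only: mult_ac)
  finally have "1/2 + 20/63 * (real n1 + 1) \<le> real n1 - real s"
    by (rule mult_right_le_imp_le) (use n1 in simp)
  then show ?thesis by argo
qed

abbreviation "gain \<equiv> min (1/2) (39/100 + 2 / real n)"

lemma n_inverse:
  "1 / real n > 0" "real n2 * (1 / real n) \<le> 1/2" "1 / real n \<le> 1 / (2 * real n2)"
  using n by (auto simp: field_simps)

text \<open>The left side is the half-energy cost of raising the threshold from the average degree
  of T1 to that of T for \<open>s\<close> eigenvectors.\<close>

lemma ratio_term: "2 * real s * real n2 / (real n1 * real n) \<le> 86/63 * (real n2 * (1 / real n))"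
proof -
  have "real s / real n1 \<le> 43/63" using count_bound n by (simp add: field_simps)
  then have "real s / real n1 * (2 * real n2 * (1 / real n)) \<le> 43/63 * (2 * real n2 * (1 / real n))"
    by (intro mult_right_mono) auto
  then show ?thesis by (simp add: field_simps)
qed

lemma gain_cases: "gain = 1/2 \<or> gain = 39/100 + 2 * (1 / real n)" "gain \<ge> 39/100"
  using n_inverse(1) by (auto simp: min_def)

text \<open>\<open>100/157\<close> stands for 2/pi. From \<open>n2 = 7\<close> on, the constant part
  39/100 of the gain is enough; for \<open>n2 = 6\<close> both branches of the minimum are
  examined.\<close>

lemma star_inequality:
  "100/157 * real n2 \<le> real n2 - 2 + 2 / real n + gain - 2 * real s * real n2 / (real n1 * real n)"
proof (cases "n2 = 6")
  case True
  have "1 / real n \<le> 1/12" using n_inverse(3) True by simp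
  then show ?thesis using ratio_term gain_cases(1) True by (elim disjE) (simp_all add: field_simps)
next
  case False
  then have "real n2 \<ge> 7" using n by simp
  then show ?thesis using ratio_term gain_cases(2) n_inverse by argo
qed

lemma double_star_inequality:
  assumes "n2 \<ge> 7"
  shows "100/157 * real n2 \<le> real n2 - 2 - 58/100 + 4 / real n + gain
    - 2 * real s * real n2 / (real n1 * real n)"
proof (cases "n2 = 7")
  case True
  have "1 / real n \<le> 1/14" using n_inverse(3) True by simp
  then show ?thesis using ratio_term gain_cases(1) True by (elim disjE) (simp_all add: field_simps)
next
  case False
  then have "real n2 \<ge> 8" using assms by simp
  then show ?thesis using ratio_term gain_cases(2) n_inverse by argo
qed

text \<open>Up to \<open>n1 = 12\<close> the integrality of \<open>s\<close> decides. Beyond that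
  the linear bound suffices and, after multiplication by \<open>n1\<close> and \<open>n\<close>,
  leaves quadratic inequalities in \<open>n1\<close>.\<close>

lemma double_star_inequality_six:
  assumes "n2 = 6"
  shows "100/157 * real n2 \<le> real n2 - 2 - 49/100 + 4 / real n + gain
    - 2 * real s * real n2 / (real n1 * real n)"
proof (cases "n1 \<le> 12")
  case True
  then consider "n1 = 6" | "n1 = 7" | "n1 = 8" | "n1 = 9" | "n1 = 10" | "n1 = 11" | "n1 = 12"
    using n assms by linarith
  then show ?thesis
  proof cases
    case 1
    then have "s \<le> 3" using count_bound_exact by simp
    then show ?thesis using 1 n(1) assms by simp
  next
    case 2
    then have "s \<le> 3" using count_bound_exact by simp
    then show ?thesis using 2 n(1) assms by simp
  next
    case 3
    then have "s \<le> 4" using count_bound_exact by simp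
    then show ?thesis using 3 n(1) assms by simp
  next
    case 4
    then have "s \<le> 5" using count_bound_exact by simp
    then show ?thesis using 4 n(1) assms by simp
  next
    case 5
    then have "s \<le> 5" using count_bound_exact by simp
    then show ?thesis using 5 n(1) assms by simp
  next
    case 6
    then have "s \<le> 6" using count_bound_exact by simp
    then show ?thesis using 6 n(1) assms by simp
  next
    case 7
    then have "s \<le> 7" using count_bound_exact by simp
    then show ?thesis using 7 n(1) assms by simp
  qed
next
  case False
  define x where "x = real n1"
  have x: "x \<ge> 13" "real n = x + 6" using False n(1) assms by (auto simp: x_def)
  have "12 * real s / x \<le> 12 * (43/63 * x - 103/126) / x"
    using count_bound x by (intro divide_right_mono mult_left_mono) (auto simp: x_def)
  also have "\<dots> = 172/21 - 206/21 / x" using x by (simp add: field_simps)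
  finally have ratio: "12 * real s / x \<le> 172/21 - 206/21 / x" .
  \<comment> \<open>31167/100000 is 600/157 - 351/100 rounded up: the target for
    \<open>n2 = 6\<close> minus the constant part 6 - 2 - 49/100 of the contribution.\<close>
  have quad: "(172/21 - 206/21 / x - 4) \<le> (gain - (31167/100000)) * (x + 6)"
  proof -
    from gain_cases(1) show ?thesis
    proof
      assume g: "gain = 1/2"
      \<comment> \<open>The scaled quadratic is about 10 x^2 - 162.5 x + 520.9; this product lies
        below it and vanishes at the end of the range.\<close>
      have "0 \<le> (x - 13) * (10 * x - 33)" using x by (intro mult_nonneg_nonneg) auto
      then have "0 \<le> 10 * x\<^sup>2 - 163 * x + 429" by (simp add: power2_eq_square algebra_simps)
      then show ?thesis unfolding g using x by (simp add: field_simps power2_eq_square)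
    next
      assume g: "gain = 39/100 + 2 * (1 / real n)"
      \<comment> \<open>Here the scaled quadratic is about x^2 - 21.96 x + 125.2, which exceeds this
        square.\<close>
      have "0 \<le> (x - 11)\<^sup>2" by simp
      then have "0 \<le> x\<^sup>2 - 22 * x + 121" by (simp add: power2_eq_square algebra_simps)
      then have "172/21 - 206/21 / x - 4 \<le> 7833/100000 * (x + 6) + 2"
        using x by (simp add: field_simps power2_eq_square)
      also have "2 = 2 * (1 / real n) * (x + 6)"
      proof -
        have "1 / y * y = 1" if "y \<noteq> 0" for y :: real using that by simp
        from this[of "x + 6"] x(1) have "1 / (x + 6) * (x + 6) = 1" by auto
        then show ?thesis unfolding x(2) by (simp only: mult.assoc mult_1_right)
      qed
      finally show ?thesis unfolding g by (simp only: distrib_right[symmetric]) (simp add: algebra_simps)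
    qed
  qed
  have "(12 * real s / x - 4) / (x + 6) \<le> (gain - 31167/100000) * (x + 6) / (x + 6)"
    using ratio quad x by (intro divide_right_mono) auto
  also have "\<dots> = gain - 31167/100000" using x by simp
  finally have "12 * real s / x / (x + 6) - 4 / (x + 6) \<le> gain - 31167/100000"
    by (simp add: diff_divide_distrib)
  moreover have "2 * real s * real n2 / (real n1 * real n) = 12 * real s / x / (x + 6)"
    using assms x by (simp add: x_def)
  moreover have "4 / real n = 4 / (x + 6)" using x by simp
  moreover have "real n2 = 6" using assms by simp
  ultimately show ?thesis by argo
qed

lemma energy_inequality:
  assumes "LT \<ge> L + 2 * real s * (2 / real n - 2 / real n1) + 2 * F + 2 * gain"
    and "100/157 * real n2 \<le> F + gain - 2 * real s * real n2 / (real n1 * real n)"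
  shows "LT \<ge> 2 + 4 * real n / pi"
proof -
  have "2 / real n1 - 2 / real n = 2 * real n2 / (real n1 * real n)" using n by (simp add: field_simps)
  then have "real s * (2 / real n1 - 2 / real n) = real s * (2 * real n2 / (real n1 * real n))" by simp
  moreover have "2 / pi * real n2 \<le> 100/157 * real n2" using two_div_pi by (intro mult_right_mono) auto
  moreover have "4 * real n / pi = 4 * real n1 / pi + 2 * (2 / pi * real n2)"
    by (simp add: n(1) field_simps)
  ultimately show ?thesis using assms L(1) by (simp add: algebra_simps)
qed

end

section \<open>Degrees, orders and sizes under joining\<close>

lemma tree_arcs_neighbour:
  assumes "tree_arcs V E" "2 \<le> card V" "x \<in> V"
  shows "\<exists>y. (x, y) \<in> E"
  using assms
proof (induction arbitrary: x rule: tree_arcs.induct)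
  case (leaf V E y z)
  show ?case
  proof (cases "x = z \<or> x = y")
    case False
    then have x: "x \<in> V" "x \<noteq> y" using leaf.prems(2) by auto
    have fin: "finite V" using tree_arcs_card[OF leaf.hyps(1)] by blast
    have "card {x, y} \<le> card V" using fin x(1) leaf.hyps(2) by (intro card_mono) auto
    then show ?thesis using leaf.IH[OF _ x(1)] x(2) by auto
  qed auto
qed simp

lemma degree_pos:
  assumes "undirected_tree G" "2 \<le> graph_order G" "x \<in> pverts G"
  shows "1 \<le> card {y. (x, y) \<in> parcs G}"
proof -
  have "pair_graph G" using assms(1) by (simp add: undirected_tree_def)
  then have "finite {y. (x, y) \<in> parcs G}"
    using pair_graph_simps(1,3)[of G] by (auto intro: finite_subset[of _ "pverts G"])
  moreover have "{y. (x, y) \<in> parcs G} \<noteq> {}"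
    using tree_arcs_neighbour[OF undirected_tree_tree_arcs[OF assms(1)]] assms(2,3)
    by (auto simp: graph_order_def)
  ultimately show ?thesis by (simp add: Suc_le_eq card_gt_0_iff)
qed

lemma avg_degree_eq:
  assumes "graph_size G + 1 = graph_order G"
  shows "avg_degree G = 2 - 2 / real (graph_order G)"
proof -
  have "real (graph_order G) = real (graph_size G) + 1" using assms by linarith
  then show ?thesis unfolding avg_degree_def by (simp add: field_simps)
qed

lemma pair_graph_join:
  assumes "pair_graph G" "pair_graph H" "pverts G \<inter> pverts H = {}" "u \<in> pverts G" "v \<in> pverts H"
  shows "pair_graph (join_by_edge G u v H)"
proof -
  note S1 = pair_graph_simps[OF assms(1)] and S2 = pair_graph_simps[OF assms(2)]
  have ne: "u \<noteq> v" using assms(3-5) by auto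
  show ?thesis
  proof (unfold_locales, goal_cases)
    case (1 e)
    then show ?case using S1(3) S2(3) assms(4,5) by (cases e) (auto simp: join_by_edge_def)
  next
    case (2 e)
    then show ?case using S1(3) S2(3) assms(4,5) by (cases e) (auto simp: join_by_edge_def)
  next
    case 3
    then show ?case using S1(1) S2(1) by (simp add: join_by_edge_def)
  next
    case 4
    then show ?case using S1(2) S2(2) by (simp add: join_by_edge_def)
  next
    case (5 e)
    then show ?case using S1(5) S2(5) ne by (cases e) (auto simp: join_by_edge_def)
  next
    case 6
    have "sym (parcs G \<union> parcs H \<union> {(u, v), (v, u)})"
      using S1(4) S2(4) by (intro sym_Un) (auto simp: sym_def)
    then show ?case by (simp add: symmetric_def join_by_edge_def)
  qed
qed

lemma graph_order_join:
  assumes "pair_graph G" "pair_graph H" "pverts G \<inter> pverts H = {}"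
  shows "graph_order (join_by_edge G u v H) = graph_order G + graph_order H"
  using assms pair_graph_simps(1)[of G] pair_graph_simps(1)[of H]
  by (simp add: graph_order_def join_by_edge_def card_Un_disjoint)

lemma graph_size_join:
  assumes "pair_graph G" "pair_graph H" "pverts G \<inter> pverts H = {}" "u \<in> pverts G" "v \<in> pverts H"
  shows "graph_size (join_by_edge G u v H) = graph_size G + graph_size H + 1"
proof -
  note S1 = pair_graph_simps[OF assms(1)] and S2 = pair_graph_simps[OF assms(2)]
  have ne: "u \<noteq> v" using assms(3-5) by auto
  have "card ((parcs G \<union> parcs H) \<union> {(u, v), (v, u)}) = card (parcs G \<union> parcs H) + card {(u, v), (v, u)}"
    by (rule card_Un_disjoint) (use S1 S2 assms in auto)
  also have "card (parcs G \<union> parcs H) = card (parcs G) + card (parcs H)"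
    by (rule card_Un_disjoint) (use S1 S2 assms in auto)
  finally have "card (parcs (join_by_edge G u v H)) = card (parcs G) + card (parcs H) + 2"
    using ne by (simp add: join_by_edge_def)
  then show ?thesis
    using card_arcs_eq[OF assms(1)] card_arcs_eq[OF assms(2)] card_arcs_eq[OF pair_graph_join[OF assms]]
    by simp
qed

text \<open>
  Vectors supported on the two halves of a double star suffice for at least seven vertices; for
  six vertices the test vectors are integer approximations of the two leading eigenvectors.
\<close>

lemma (in laplacian_eigenbasis) double_star_eigenvalue_sum:
  fixes c d :: 'a
  assumes G: "c \<noteq> d" "{c, d} \<inter> (A \<union> B) = {}" "A \<inter> B = {}" "pverts G = {c, d} \<union> A \<union> B"
      "parcs G = double_star c d A B"
    and n: "graph_order G \<ge> 6"
  defines "F \<equiv> \<lambda>t. \<Sum>j | j < graph_order G \<and> ev j \<ge> t. ev j - t"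
  shows "(\<forall>t. F t \<ge> real (graph_order G) - t) \<or>
    (graph_order G \<ge> 7 \<and> (\<forall>t. F t \<ge> real (graph_order G) + 2 - 58/100 - 2 * t)) \<or>
    (graph_order G = 6 \<and> (\<forall>t. F t \<ge> real (graph_order G) + 2 - 49/100 - 2 * t))"
proof -
  have fin: "finite A" "finite B" using G(4) simps(1) by auto
  note ip = inner_on_two_level[OF G(1-4) simps(1)] and di = dirichlet_two_level[OF G(1-4) simps(1), folded G(5)]
  have ord: "graph_order G = card A + card B + 2"
  proof -
    have "pverts G = {c, d} \<union> (A \<union> B)" using G(4) by blast
    then have "graph_order G = card {c, d} + card (A \<union> B)"
      unfolding graph_order_def using G(2) fin by (simp only:) (rule card_Un_disjoint, auto)
    then show ?thesis using G(1,3) fin by (simp add: card_Un_disjoint)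
  qed
  define a b where "a = card A" and "b = card B"
  let ?tl = "two_level c d A B"
  have pair: "F t \<ge> dirichlet (parcs G) f f / inner_on (pverts G) f f
      + dirichlet (parcs G) h h / inner_on (pverts G) h h - 2 * t"
    if "inner_on (pverts G) f f > 0" "inner_on (pverts G) h h > 0" "inner_on (pverts G) f h = 0" for f h t
    unfolding F_def using two_vectors_le[OF that] .
  have single: "F t \<ge> dirichlet (parcs G) f f / inner_on (pverts G) f f - t"
    if "inner_on (pverts G) f f > 0" for f t
    unfolding F_def using single_vector_le[OF that] .
  define N where "N = real (graph_order G)"
  have N: "N = real a + real b + 2" "N \<ge> 6" using ord n by (simp_all add: N_def a_def b_def)
  consider "a = 0" | "b = 0" | "a \<ge> 1" "b \<ge> 1" by linarith
  then show ?thesis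
  proof cases
    case 1
    \<comment> \<open>Without \<open>A\<close> the tree is a star centred at \<open>d\<close>, with
      \<open>c\<close> among its leaves. This is its top eigenvector, of eigenvalue
      \<open>N\<close>.\<close>
    let ?f = "?tl (-1) 0 (N - 1) (-1)"
    have "inner_on (pverts G) ?f ?f = N * (N - 1)" "dirichlet (parcs G) ?f ?f = N * (N * (N - 1))"
      using 1 N(1) by (simp_all add: ip di a_def[symmetric] b_def[symmetric] power2_eq_square algebra_simps)
    then have "F t \<ge> N - t" for t using single[of ?f t] N(2) by simp
    then show ?thesis by (simp add: N_def)
  next
    case 2
    let ?f = "?tl (N - 1) (-1) (-1) 0"
    have "inner_on (pverts G) ?f ?f = N * (N - 1)" "dirichlet (parcs G) ?f ?f = N * (N * (N - 1))"
      using 2 N(1) by (simp_all add: ip di a_def[symmetric] b_def[symmetric] power2_eq_square algebra_simps)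
    then have "F t \<ge> N - t" for t using single[of ?f t] N(2) by simp
    then show ?thesis by (simp add: N_def)
  next
    case 3
    show ?thesis
    proof (cases "graph_order G = 6")
      case True
      \<comment> \<open>751/100 is 6 + 2 - 49/100. The split into 1 and 3 is the worst one tested:
        it gives 101/20 + 192/78, about 7.5115.\<close>
      have six: "(\<forall>t. F t \<ge> 751/100 - 2 * t) \<Longrightarrow> ?thesis" using True by simp
      consider "a = 1" "b = 3" | "a = 2" "b = 2" | "a = 3" "b = 1"
        using 3 True ord unfolding a_def b_def by linarith
      then show ?thesis
      proof cases
        case 1
        then have "F t \<ge> 751/100 - 2 * t" for t
          using pair[of "?tl (-1) 0 4 (-1)" "?tl (-7) 5 (-1) 1" t]
          by (simp add: ip di a_def[symmetric] b_def[symmetric])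
        then show ?thesis using six by blast
      next
        \<comment> \<open>Exchanging the centres separates odd from even vectors; the even one is an
          exact eigenvector, of eigenvalue 3.\<close>
        case 2
        then have "F t \<ge> 751/100 - 2 * t" for t
          using pair[of "?tl 3 (-1) (-3) 1" "?tl 2 (-1) 2 (-1)" t]
          by (simp add: ip di a_def[symmetric] b_def[symmetric])
        then show ?thesis using six by blast
      next
        case 3
        then have "F t \<ge> 751/100 - 2 * t" for t
          using pair[of "?tl 4 (-1) (-1) 0" "?tl (-1) 1 (-7) 5" t]
          by (simp add: ip di a_def[symmetric] b_def[symmetric])
        then show ?thesis using six by blast
      qed
    next
      case False
      \<comment> \<open>Each vector is the Laplacian row at a centre with the entry at the other
        centre cleared.\<close>
      let ?f = "?tl (real a + 1) (-1) 0 0" and ?h = "?tl 0 0 (real b + 1) (-1)"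
      let ?q = "\<lambda>k::nat. (real k + 1)\<^sup>2 + real k"
      have q: "?q k > 0" for k :: nat by (simp add: add_pos_nonneg)
      have "inner_on (pverts G) ?f ?f = ?q a" "inner_on (pverts G) ?h ?h = ?q b" "inner_on (pverts G) ?f ?h = 0"
        "dirichlet (parcs G) ?f ?f = (real a + 2) * ?q a - (real a + 1)"
        "dirichlet (parcs G) ?h ?h = (real b + 2) * ?q b - (real b + 1)"
        by (simp_all add: ip di a_def[symmetric] b_def[symmetric] power2_eq_square algebra_simps)
      then have F: "F t \<ge> (real a + 2 - (real a + 1) / ?q a) + (real b + 2 - (real b + 1) / ?q b) - 2 * t" for t
        using pair[of ?f ?h t] q[of a] q[of b] by (simp add: diff_divide_distrib)
      have e1: "(real k + 1) / ?q k \<le> 2/5" if "k \<ge> 1" for k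
        using star_defect_antimono[of 1 k] that by simp
      have e2: "(real k + 1) / ?q k \<le> 3/11" if "k \<ge> 2" for k
        using star_defect_antimono[of 2 k] that by simp
      have e4: "(real k + 1) / ?q k \<le> 5/29" if "k \<ge> 4" for k
        using star_defect_antimono[of 4 k] that by simp
      \<comment> \<open>58/100 rounds up 2/5 + 5/29, from the split into 1 and 4; two leaf sets of
        size 2 or more give at most 6/11.\<close>
      have "(real a + 1) / ?q a + (real b + 1) / ?q b \<le> 58/100"
      proof -
        have "a + b \<ge> 5" using False n ord by (simp add: a_def b_def)
        then consider "a \<ge> 1" "b \<ge> 4" | "a \<ge> 4" "b \<ge> 1" | "a \<ge> 2" "b \<ge> 2" using 3 by linarith
        then show ?thesis
        proof cases
          case 1
          show ?thesis using e1[OF 1(1)] e4[OF 1(2)] by argo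
        next
          case 2
          show ?thesis using e4[OF 2(1)] e1[OF 2(2)] by argo
        next
          case 3
          show ?thesis using e2[OF 3(1)] e2[OF 3(2)] by argo
        qed
      qed
      then have "F t \<ge> N + 2 - 58/100 - 2 * t" for t using F[of t] N(1) by argo
      then show ?thesis using False n by (simp add: N_def)
    qed
  qed
qed

theorem theorem3p5:
  fixes T1 T2 T :: "'a pair_pre_digraph" and u v :: 'a and n1 n2 n r1 \<sigma>1 :: nat
  assumes T1: "undirected_tree T1" "n1 = graph_order T1"
    and r1: "r1 = card (non_pendent T1)"
    and T2: "undirected_tree T2" "n2 = graph_order T2" "graph_diameter T2 \<le> 3"
    and orders: "n1 \<ge> n2" "n2 \<ge> 6"
    and \<sigma>1: "\<sigma>1 = size {# \<mu> \<in># laplacian_spectrum T1. \<mu> \<ge> avg_degree T1 #}"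
    and disjoint: "pverts T1 \<inter> pverts T2 = {}"
    and uv: "u \<in> pverts T1" "v \<in> pverts T2"
    and T: "T = join_by_edge T1 u v T2" "n = n1 + n2"
    and eq: "\<sigma>1 = r1"
    and LE1: "laplacian_energy T1 \<ge> 2 + 4 * real n1 / pi"
  shows "laplacian_energy T \<ge> 2 + 4 * real n / pi
       \<and> laplacian_energy T \<ge> laplacian_energy (path_graph n)"
proof -
  have pg: "pair_graph T1" "pair_graph T2" using T1(1) T2(1) by (simp_all add: undirected_tree_def)
  have pgT: "pair_graph T" unfolding T(1) by (rule pair_graph_join[OF pg disjoint uv])
  obtain g ev where G1: "laplacian_eigenbasis T1 g ev" using laplacian_eigenbasis_exists[OF pg(1)] by blast
  obtain h fv where G2: "laplacian_eigenbasis T2 h fv" using laplacian_eigenbasis_exists[OF pg(2)] by blast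
  obtain k kv where GT: "laplacian_eigenbasis T k kv" using laplacian_eigenbasis_exists[OF pgT] by blast
  interpret G1: laplacian_eigenbasis T1 g ev by (rule G1)
  interpret G2: laplacian_eigenbasis T2 h fv by (rule G2)
  have order_T: "graph_order T = n"
    unfolding T T1(2) T2(2) by (rule graph_order_join[OF pg disjoint])
  have d1: "avg_degree T1 = 2 - 2 / real n1"
    unfolding T1(2) by (rule avg_degree_eq[OF tree_size[OF T1(1)]])
  have "graph_size T + 1 = graph_order T"
    using graph_size_join[OF pg disjoint uv] tree_size[OF T1(1)] tree_size[OF T2(1)] order_T
    by (simp add: T T1(2) T2(2))
  from avg_degree_eq[OF this] have d: "avg_degree T = 2 - 2 / real n" by (simp add: order_T)
  define I where "I = {i. i < graph_order T1 \<and> ev i \<ge> avg_degree T1}"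
  define J where "J = {j. j < graph_order T2 \<and> fv j \<ge> avg_degree T}"
  define F where "F = (\<Sum>j\<in>J. fv j - avg_degree T)"
  have sub: "I \<subseteq> {..<graph_order T1}" "J \<subseteq> {..<graph_order T2}" by (auto simp: I_def J_def)
  have card_I: "card I = \<sigma>1" unfolding \<sigma>1 I_def by (rule G1.size_filter_spectrum[symmetric])
  have "2 \<le> graph_order T1" "2 \<le> graph_order T2" using orders T1(2) T2(2) by simp_all
  then have deg: "1 \<le> card {y. (u, y) \<in> parcs T1}" "1 \<le> card {y. (v, y) \<in> parcs T2}"
    using degree_pos[OF T1(1) _ uv(1)] degree_pos[OF T2(1) _ uv(2)] by simp_all
  \<comment> \<open>\<open>I\<close> is cut at the threshold of T1, so that LE(T1) is recovered
    exactly; measuring against the average degree of T shifts each term by the same amount.\<close>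
  have "(\<Sum>i\<in>I. ev i - avg_degree T)
      = (\<Sum>i\<in>I. ev i - avg_degree T1) + real \<sigma>1 * (avg_degree T1 - avg_degree T)"
    by (simp add: sum_subtractf card_I algebra_simps)
  moreover have "laplacian_energy T1 = 2 * (\<Sum>i\<in>I. ev i - avg_degree T1)"
    unfolding I_def by (rule G1.laplacian_energy_filter)
  moreover have da: "avg_degree T1 - avg_degree T = 2 / real n - 2 / real n1" by (simp add: d d1)
  ultimately have sum_I: "2 * (\<Sum>i\<in>I. ev i - avg_degree T)
      = laplacian_energy T1 + 2 * real \<sigma>1 * (2 / real n - 2 / real n1)"
    unfolding da[symmetric] by argo
  have LT: "laplacian_energy T \<ge> laplacian_energy T1 + 2 * real \<sigma>1 * (2 / real n - 2 / real n1)
      + 2 * F + 2 * min (1/2) (39/100 + 2 / real n)"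
    using join_energy_gain[OF G1 G2 GT disjoint uv T(1) sub deg] sum_I by (simp add: F_def d)
  have "laplacian_energy T1 \<le> 2 * (real n1 - real \<sigma>1) * avg_degree T1"
    unfolding \<sigma>1 T1(2) by (rule G1.laplacian_energy_le)
  then have L_le: "laplacian_energy T1 \<le> 2 * (real n1 - real \<sigma>1) * (2 - 2 / real n1)"
    unfolding d1 .
  note numerics = T(2) orders LE1 L_le
  have near: "near (parcs T2) a b" if "a \<in> pverts T2" "b \<in> pverts T2" for a b
    by (rule diameter_near[OF pg(2) T2(3) that])
  have "2 \<le> card (pverts T2)" using orders T2(2) by (simp add: graph_order_def)
  then have "\<exists>c d A B. c \<noteq> d \<and> {c, d} \<inter> (A \<union> B) = {} \<and> A \<inter> B = {} \<and>
      pverts T2 = {c, d} \<union> A \<union> B \<and> parcs T2 = double_star c d A B"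
    by (rule tree_diameter_three[OF undirected_tree_tree_arcs[OF T2(1)]]) (rule near)
  then obtain c e A B where ds: "c \<noteq> e" "{c, e} \<inter> (A \<union> B) = {}" "A \<inter> B = {}"
    "pverts T2 = {c, e} \<union> A \<union> B" "parcs T2 = double_star c e A B" by blast
  have "graph_order T2 \<ge> 6" using orders T2(2) by simp
  from G2.double_star_eigenvalue_sum[OF ds this, folded T2(2)]
  have F: "real n2 - 2 + 2 / real n \<le> F \<or>
      (n2 \<ge> 7 \<and> real n2 - 2 - 58/100 + 4 / real n \<le> F) \<or>
      (n2 = 6 \<and> real n2 - 2 - 49/100 + 4 / real n \<le> F)"
    unfolding F_def J_def d T2(2)[symmetric]
    by (elim disjE conjE; drule_tac x="2 - 2 / real n" in spec) simp_all
  then have "100/157 * real n2 \<le> F + min (1/2) (39/100 + 2 / real n)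
      - 2 * real \<sigma>1 * real n2 / (real n1 * real n)"
    using star_inequality[OF numerics] double_star_inequality[OF numerics]
      double_star_inequality_six[OF numerics] by (elim disjE conjE) simp_all
  from energy_inequality[OF numerics LT this]
  have main: "laplacian_energy T \<ge> 2 + 4 * real n / pi" .
  moreover have "laplacian_energy (path_graph n) \<le> 2 + 4 * real n / pi"
    by (rule laplacian_energy_path_le) (use T(2) orders in simp)
  ultimately show ?thesis by simp
qed

end
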